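(* Let $p,q\in[1,\infty]$, and let $p',q'$ denote their conjugate exponents. The following three conditions are equivalent. (1) The estimate \[ \|\widehat{f}\|_{\mathrm{L}^q(\mathbb{T}^d)} \leq \|f\|_{\ell^p(\{0,1\}^d)} \] holds for every positive integer $d$ and every function $f\colon\mathbb{Z}^d\to\mathbb{C}$ supported in $\{0,1\}^d$. (2) The estimate \[ \big\|\widehat{g}\big|_{\{0,1\}^d}\big\|_{\ell^{p'}(\{0,1\}^d)} \leq \|g\|_{\mathrm{L}^{q'}(\mathbb{T}^d)} \] holds for every positive integer $d$ and every $g\in\mathrm{L}^{q'}(\mathbb{T}^d)$. (3) The exponents $p,q$ satisfy \[ \frac{1}{p} \geq \begin{cases} 1 & \text{for } q=\infty, \\ \displaystyle\frac{1}{q}\log_2\binom{q}{q/2} & \text{for } q\in[2,\infty), \\ \displaystyle\frac{1}{2} & \text{for } q\in[1,2). \end{cases} \]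
   Context: $\mathbb{T}^d=(\mathbb{R}/\mathbb{Z})^d$ carries the Haar probability measure $\mathrm{d}\xi$. For $f\in\ell^1(\mathbb{Z}^d)$, $\widehat{f}\colon\mathbb{T}^d\to\mathbb{C}$ is $\widehat{f}(\xi):=\sum_{x\in\mathbb{Z}^d} f(x)e^{-2\pi i x\cdot\xi}$. For $g\in\mathrm{L}^1(\mathbb{T}^d)$, $\widehat{g}\colon\mathbb{Z}^d\to\mathbb{C}$ is $\widehat{g}(x):=\int_{\mathbb{T}^d} g(\xi)e^{-2\pi i x\cdot\xi}\,\mathrm{d}\xi$. Conjugate exponents satisfy $1/p+1/p'=1$, $1/q+1/q'=1$, with the convention $1/\infty=0$. The $\ell^p$ norms are with respect to counting measure. The generalized binomial coefficient is $\binom{a}{b}:=\frac{\Gamma(a+1)}{\Gamma(b+1)\Gamma(a-b+1)}$ for real $a,b$ with $\min\{a,b,a-b\}>-1$. *)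

theory Defs
  imports "HOL-Probability.Probability"
begin

text \<open>
  The dimension is a natural number, so points of the lattice, of the cube and of the torus
  are extensional functions on \<open>{..<d}\<close>.
\<close>

definition lattice :: "nat \<Rightarrow> (nat \<Rightarrow> int) set" where
  "lattice d = {..<d} \<rightarrow>\<^sub>E UNIV"

definition cube :: "nat \<Rightarrow> (nat \<Rightarrow> int) set" where
  "cube d = {..<d} \<rightarrow>\<^sub>E {0, 1}"

text \<open>
  The circle \<open>\<real>/\<int>\<close> is represented by its fundamental domain \<open>[0,1)\<close>. Lebesgue measure on
  this domain corresponds to the Haar probability measure of \<open>\<real>/\<int>\<close>, and the product measure
  to that of the torus. The Borel \<open>\<sigma>\<close>-algebra is used, without completion: every class
  modulo null sets of Lebesgue measurable functions has a Borel representative.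
\<close>

definition circle :: "real measure" where
  "circle = restrict_space lborel {0..<1}"

definition torus :: "nat \<Rightarrow> (nat \<Rightarrow> real) measure" where
  "torus d = (\<Pi>\<^sub>M i\<in>{..<d}. circle)"

lemma prob_space_circle: "prob_space circle"
  by (rule prob_spaceI) (simp add: circle_def space_restrict_space emeasure_restrict_space)

lemma prob_space_torus: "prob_space (torus d)"
  unfolding torus_def by (intro prob_space_PiM prob_space_circle)

text \<open>As a function of \<open>\<xi>\<close> this is periodic modulo \<open>\<int>\<^sup>d\<close>, hence well defined on the torus.\<close>

definition character :: "nat \<Rightarrow> (nat \<Rightarrow> int) \<Rightarrow> (nat \<Rightarrow> real) \<Rightarrow> complex" where
  "character d x \<xi> = exp (- 2 * of_real pi * \<i> * of_real (\<Sum>i<d. of_int (x i) * \<xi> i))"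

definition fourier_lattice :: "nat \<Rightarrow> ((nat \<Rightarrow> int) \<Rightarrow> complex) \<Rightarrow> (nat \<Rightarrow> real) \<Rightarrow> complex" where
  "fourier_lattice d f \<xi> = (\<Sum>\<^sub>\<infinity>x\<in>lattice d. f x * character d x \<xi>)"

definition fourier_torus :: "nat \<Rightarrow> ((nat \<Rightarrow> real) \<Rightarrow> complex) \<Rightarrow> (nat \<Rightarrow> int) \<Rightarrow> complex" where
  "fourier_torus d g x = (LINT \<xi>|torus d. g \<xi> * character d x \<xi>)"

text \<open>
  Exponents range over \<open>[1,\<infinity>]\<close> as a subset of \<^typ>\<open>ennreal\<close>, where \<open>1 / \<infinity> = 0\<close>.
  The norm is real-valued and meaningful only on \<open>Lp_space\<close>. Over a counting measure it is
  the \<open>\<ell>\<^sup>p\<close> norm.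
\<close>

definition Lp_space :: "ennreal \<Rightarrow> 'a measure \<Rightarrow> ('a \<Rightarrow> complex) set" where
  "Lp_space p M =
     {f \<in> borel_measurable M.
        if p = \<infinity> then esssup M (\<lambda>x. ennreal (norm (f x))) < \<infinity>
        else integrable M (\<lambda>x. norm (f x) powr enn2real p)}"

definition Lp_norm :: "ennreal \<Rightarrow> 'a measure \<Rightarrow> ('a \<Rightarrow> complex) \<Rightarrow> real" where
  "Lp_norm p M f =
     (if p = \<infinity> then enn2real (esssup M (\<lambda>x. ennreal (norm (f x))))
      else (LINT x|M. norm (f x) powr enn2real p) powr (1 / enn2real p))"

text \<open>Unlike \<open>gchoose\<close>, the lower argument is real; meant for \<open>min {a, b, a - b} > -1\<close>.\<close>

definition real_binomial :: "real \<Rightarrow> real \<Rightarrow> real" where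
  "real_binomial a b = Gamma (a + 1) / (Gamma (b + 1) * Gamma (a - b + 1))"

end

theory Submission
  imports Defs
begin

text \<open>
  The conditions are proved in a cycle (3), (1), (2), (3).

  For \<open>q \<ge> 2\<close> the estimate tensorises by Minkowski's inequality, as \<open>p \<le> q\<close>, so
  everything rests on the two-point inequality
  \<open>\<integral> (1 + x\<^sup>2 + 2 x cos)\<^sup>r \<le> (1 + x\<^sup>p)\<^bsup>q/p\<^esup>\<close> for \<open>0 \<le> x \<le> 1\<close>, \<open>r = q/2\<close>,
  at the critical exponent \<open>p\<close>, where equality holds at both \<open>x = 0\<close> and \<open>x = 1\<close>.
  With \<open>x = exp (- v)\<close> the left-hand side is governed by \<open>J v = \<integral> (cosh v + cos)\<^sup>r\<close>, which solves
  \<open>J'' + r\<^sup>2 J = 2 r coth v J'\<close>. At a critical point the logarithm of the quotient of the two sides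
  therefore has a second derivative with the sign of
  \<open>p/2 - r sinh ((p - 1) v) / sinh v\<close>, an increasing function of \<open>v\<close>. The logarithm is positive
  for large \<open>v\<close>; if it were negative somewhere, it would have a local minimum
  and, at a larger \<open>v\<close>, a local maximum, which contradicts the monotonicity.

  For \<open>q < 2\<close> one compares with \<open>q = 2\<close>. Conditions (1) and (2) are dual to each other.
  Necessity is seen in dimension one: the constant function gives the binomial bound,
  a small perturbation of a point mass gives \<open>p \<le> 2\<close>, and for \<open>q = \<infinity>\<close> a Fejer kernel
  gives \<open>p = 1\<close>.
\<close>

section \<open>A one-parameter family of trigonometric integrals\<close>

lemma integral_pos_if_pos_at_point:
  fixes f :: "real \<Rightarrow> real"
  assumes "continuous_on {0..1} f" "\<And>t. t \<in> {0..1} \<Longrightarrow> f t \<ge> 0" "s \<in> {0..1}" "f s > 0"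
  shows "integral {0..1} f > 0"
proof -
  have "integral {0..1} f \<ge> 0"
    using assms by (intro integral_nonneg integrable_continuous_interval) auto
  moreover have "integral {0..1} f \<noteq> 0"
    using integral_eq_0_iff[of 0 1 f] assms by force
  ultimately show ?thesis by linarith
qed

text \<open>A negative \<open>c\<close> would make \<open>f'\<close> negative just to the right of
  the critical point \<open>x\<close>, and the mean value theorem would then produce a value of
  \<open>f\<close> below the minimum. The second derivative is taken at \<open>x\<close>
  alone.\<close>

lemma second_deriv_nonneg_at_local_min:
  fixes f f' :: "real \<Rightarrow> real"
  assumes e: "e > 0" and der: "\<And>y. \<bar>y - x\<bar> < e \<Longrightarrow> (f has_real_derivative f' y) (at y)"
    and der2: "(f' has_real_derivative c) (at x)"
    and min: "\<And>y. \<bar>y - x\<bar> < e \<Longrightarrow> f x \<le> f y"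
  shows "f' x = 0" and "c \<ge> 0"
proof -
  show z: "f' x = 0"
    using DERIV_local_min[of f "f' x" x e] der[of x] min e by (auto simp: abs_minus_commute)
  show "c \<ge> 0"
  proof (rule ccontr)
    assume "\<not> c \<ge> 0"
    then obtain d where d: "d > 0" "\<And>h. h > 0 \<Longrightarrow> h < d \<Longrightarrow> f' (x + h) < f' x"
      using DERIV_neg_dec_right[OF der2] by (auto simp: add.commute)
    define h where "h = min d e / 2"
    have h: "h > 0" "h < d" "h < e" using d e by (auto simp: h_def min_def)
    obtain z where "z > x" "z < x + h" "f (x + h) - f x = h * f' z"
      using MVT2[of x "x + h" f f'] der h by (auto simp: abs_less_iff)
    moreover have "f' z < 0" using d(2)[of "z - x"] h z calculation by auto
    ultimately have "f (x + h) < f x" using h by (smt (verit) mult_pos_neg)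
    then show False using min[of "x + h"] h by auto
  qed
qed

text \<open>The numerator of the derivative of the ratio is \<open>- ?g\<close>, where
  \<open>?g\<close> vanishes at 0 and has derivative
  \<open>(1 - k\<^sup>2) * (sinh (k * x) * sinh x)\<close>, which is positive for
  \<open>0 < k < 1\<close>. This is the monotonicity behind the final contradiction in
  \<open>cos_integral_le\<close>.\<close>

lemma sinh_ratio_strict_decreasing:
  fixes k v w :: real
  assumes k: "0 < k" "k < 1" and v: "0 < v" "v < w"
  shows "sinh (k * w) / sinh w < sinh (k * v) / sinh v"
proof -
  have g: "k * cosh (k * u) * sinh u < sinh (k * u) * cosh u" if "u > 0" for u
  proof -
    let ?g = "\<lambda>u. sinh (k * u) * cosh u - k * cosh (k * u) * sinh u"
    have "?g 0 < ?g u"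
    proof (rule DERIV_pos_imp_increasing_open[OF that])
      fix x assume x: "0 < x" "x < u"
      have "(?g has_real_derivative (1 - k\<^sup>2) * (sinh (k * x) * sinh x)) (at x)"
        by (auto intro!: derivative_eq_intros simp: algebra_simps power2_eq_square)
      moreover have "(1 - k\<^sup>2) * (sinh (k * x) * sinh x) > 0"
        using x k by (intro mult_pos_pos) (auto simp: power_less_one_iff)
      ultimately show "\<exists>y. (?g has_real_derivative y) (at x) \<and> 0 < y" by blast
    qed (auto intro!: continuous_intros)
    then show ?thesis by simp
  qed
  show ?thesis
  proof (rule DERIV_neg_imp_decreasing[OF v(2)])
    fix x assume x: "v \<le> x" "x \<le> w"
    with v have x0: "x > 0" by simp
    let ?d = "(k * cosh (k * x) * sinh x - sinh (k * x) * cosh x) / (sinh x)\<^sup>2"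
    have "((\<lambda>x. sinh (k * x) / sinh x) has_real_derivative ?d) (at x)"
      using x0 by (auto intro!: derivative_eq_intros simp: field_simps power2_eq_square)
    moreover have "?d < 0" using g[OF x0] x0 by (auto simp: divide_less_0_iff)
    ultimately show "\<exists>y. ((\<lambda>x. sinh (k * x) / sinh x) has_real_derivative y) (at x) \<and> y < 0" by blast
  qed
qed

lemma exp_le_quadratic:
  fixes w :: real
  assumes "\<bar>w\<bar> \<le> 1"
  shows "exp w \<le> 1 + w + w\<^sup>2"
proof (cases "w \<ge> 0")
  case True
  then show ?thesis using assms exp_bound[of w] by auto
next
  case False
  \<comment> \<open>For negative \<open>w\<close> the Taylor lower bound is applied to the
    reciprocal \<open>exp (- w)\<close>; its product with \<open>1 + w + w\<^sup>2\<close> is at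
    least 1, since the surplus terms are all nonnegative when \<open>w < 0\<close>.\<close>
  have "1 + (-w) + (-w)\<^sup>2 / 2 \<le> exp (-w)"
    using exp_lower_Taylor_quadratic[of "-w"] False by auto
  moreover have pos: "1 + (-w) + (-w)\<^sup>2 / 2 > 0" using False by (smt (verit) zero_le_power2 divide_nonneg_nonneg)
  ultimately have "exp w \<le> 1 / (1 - w + w\<^sup>2 / 2)"
    by (simp add: exp_minus field_simps)
  also have "\<dots> \<le> 1 + w + w\<^sup>2"
  proof -
    have "(1 + w + w\<^sup>2) * (1 - w + w\<^sup>2 / 2) = 1 + w\<^sup>2 / 2 + (- w) * w\<^sup>2 / 2 + w^4 / 2"
      by (simp add: field_simps power2_eq_square power4_eq_xxxx)
    moreover have "(- w) * w\<^sup>2 \<ge> 0" "w^4 \<ge> 0"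
      using False by (intro mult_nonneg_nonneg, auto)
    ultimately have "1 \<le> (1 + w + w\<^sup>2) * (1 - w + w\<^sup>2 / 2)" by (smt (verit) zero_le_power2 divide_nonneg_nonneg)
    then show ?thesis using pos by (simp add: divide_le_eq)
  qed
  finally show ?thesis .
qed

section \<open>The two-point norm as a function of the ratio of moduli, and its size near 0\<close>

text \<open>The base is the squared modulus of 1 + x e^(2 pi i t), so this is the L^(2r) norm of
  that function raised to the power 2r.\<close>

definition cos_integral :: "real \<Rightarrow> real \<Rightarrow> real" where
  "cos_integral r x = integral {0..1} (\<lambda>t. (1 + x\<^sup>2 + 2 * x * cos (2 * pi * t)) powr r)"

lemma cos_base_nonneg: "1 + x\<^sup>2 + 2 * x * cos a \<ge> (0 :: real)"
proof -
  have "1 + x\<^sup>2 + 2 * x * cos a = (x + cos a)\<^sup>2 + (sin a)\<^sup>2"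
    using sin_cos_squared_add[of a] by (simp add: power2_eq_square algebra_simps)
  then show ?thesis by simp
qed

lemma continuous_on_cos_integrand:
  "r > 0 \<Longrightarrow> continuous_on S (\<lambda>t. (1 + x\<^sup>2 + 2 * x * cos (2 * pi * t)) powr r)"
  by (intro continuous_on_powr' continuous_intros) (use cos_base_nonneg in auto)

lemma continuous_on_cos_integral:
  assumes "r > 0"
  shows "continuous_on S (cos_integral r)"
proof -
  have "continuous_on S (\<lambda>x. integral (cbox 0 1) (\<lambda>t. (1 + x\<^sup>2 + 2 * x * cos (2 * pi * t)) powr r))"
  proof (rule integral_continuous_on_param, unfold split_beta, rule continuous_on_powr')
    show "\<forall>z\<in>S \<times> cbox 0 1. 0 \<le> 1 + (fst z)\<^sup>2 + 2 * fst z * cos (2 * pi * snd z) \<and>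
        (1 + (fst z)\<^sup>2 + 2 * fst z * cos (2 * pi * snd z) = 0 \<longrightarrow> 0 < r)"
      using assms cos_base_nonneg by blast
  qed (intro continuous_intros)+
  then show ?thesis by (simp add: cos_integral_def[abs_def])
qed

lemma cos_integral_pos:
  assumes "r > 0" "x \<ge> 0"
  shows "cos_integral r x > 0"
  unfolding cos_integral_def
proof (rule integral_pos_if_pos_at_point[where s = 0])
  have "1 + x\<^sup>2 + 2 * x > 0" using assms by (smt (verit) zero_le_power2)
  then show "(1 + x\<^sup>2 + 2 * x * cos (2 * pi * 0)) powr r > 0"
    by simp
qed (use assms continuous_on_cos_integrand in auto)

lemma cos_integral_0: "cos_integral r 0 = 1"
  by (simp add: cos_integral_def)

lemma has_integral_cos_multiple:
  assumes "k > 0"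
  shows "((\<lambda>t. cos (2 * pi * (real k * t))) has_integral 0) {0..1}"
proof -
  let ?F = "\<lambda>t. sin (2 * pi * (real k * t)) / (2 * pi * real k)"
  have "((\<lambda>t. cos (2 * pi * (real k * t))) has_integral (?F 1 - ?F 0)) {0..1}"
    by (rule fundamental_theorem_of_calculus)
      (use assms in \<open>auto intro!: derivative_eq_intros simp: has_real_derivative_iff_has_vector_derivative[symmetric]\<close>)
  moreover have "sin (2 * pi * real k) = 0" using sin_2npi[of k] by (simp only: mult_ac)
  ultimately show ?thesis by simp
qed

lemma has_integral_cos: "((\<lambda>t. cos (2 * pi * t)) has_integral 0) {0..1}"
  using has_integral_cos_multiple[of 1] by simp

text \<open>With the base written as \<open>1 + u\<close>, one has (1 + u)^r \<le> exp (r u), and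
  the quadratic bound for the exponential leaves a single term linear in \<open>x\<close>. It is a
  multiple of the cosine and integrates to 0, so the error is of second order. Since
  \<open>u\<close> is at most \<open>3 * x\<close> in modulus, the condition
  \<open>3 * r * x \<le> 1\<close> is what the quadratic bound requires.\<close>

lemma cos_integral_le_near_0:
  assumes r: "r > 0" and x: "0 \<le> x" "x \<le> 1" "3 * r * x \<le> 1"
  shows "cos_integral r x \<le> 1 + (r + 9 * r\<^sup>2) * x\<^sup>2"
proof -
  let ?u = "\<lambda>t. x\<^sup>2 + 2 * x * cos (2 * pi * t)"
  define K where "K = 1 + (r + 9 * r\<^sup>2) * x\<^sup>2"
  let ?R = "\<lambda>t. K + 2 * r * x * cos (2 * pi * t)"
  have "(?R has_integral K) {0..1}"
    using has_integral_add[OF has_integral_const_real[of K 0 1]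
        has_integral_mult_right[OF has_integral_cos, of "2 * r * x"]] by simp
  moreover have "((\<lambda>t. (1 + ?u t) powr r) has_integral cos_integral r x) {0..1}"
    using integrable_continuous_interval[OF continuous_on_cos_integrand[OF r]]
    unfolding cos_integral_def by (simp add: add.assoc integrable_integral)
  moreover have "(1 + ?u t) powr r \<le> ?R t" for t
  proof -
    have u: "\<bar>?u t\<bar> \<le> 3 * x"
    proof -
      have "\<bar>x * cos (2 * pi * t)\<bar> \<le> x" using x by (simp add: abs_mult mult_left_le)
      moreover have "x\<^sup>2 \<le> x" using x by (simp add: power2_eq_square mult_left_le)
      moreover have "2 * x * cos (2 * pi * t) = 2 * (x * cos (2 * pi * t))" by simp
      ultimately show ?thesis using zero_le_power2[of x] x(1) unfolding abs_le_iff by linarith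
    qed
    have nn: "1 + ?u t \<ge> 0" using cos_base_nonneg[of x "2 * pi * t"] by simp
    have "(1 + ?u t) powr r \<le> exp (?u t) powr r"
      using nn r by (intro powr_mono2) auto
    also have "\<dots> = exp (r * ?u t)" by (simp add: powr_def)
    also have "\<dots> \<le> 1 + r * ?u t + (r * ?u t)\<^sup>2"
    proof (rule exp_le_quadratic)
      have "\<bar>r * ?u t\<bar> \<le> r * (3 * x)" using u r by (simp add: abs_mult)
      then show "\<bar>r * ?u t\<bar> \<le> 1" using x by (simp add: mult.commute mult.left_commute)
    qed
    also have "(r * ?u t)\<^sup>2 \<le> r\<^sup>2 * (3 * x)\<^sup>2"
    proof -
      have "(?u t)\<^sup>2 \<le> (3 * x)\<^sup>2" using u x by (intro abs_le_square_iff[THEN iffD1]) simp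
      then show ?thesis unfolding power_mult_distrib[of r] by (rule mult_left_mono) simp
    qed
    finally show ?thesis by (simp add: K_def algebra_simps power2_eq_square)
  qed
  ultimately show ?thesis unfolding K_def[symmetric] by (meson has_integral_le)
qed

text \<open>Substituting \<open>x = exp (- v)\<close> turns the integrals \<open>cos_integral\<close> into Legendre-type integrals.\<close>

definition cosh_integral :: "real \<Rightarrow> real \<Rightarrow> real" where
  "cosh_integral s v = integral {0..1} (\<lambda>t. (cosh v + cos (2 * pi * t)) powr s)"

lemma cosh_base_pos: "v > 0 \<Longrightarrow> cosh v + cos a > (0 :: real)"
proof -
  assume "v > 0"
  then have "cosh v > 1" using cosh_real_nonneg_less_iff[of 0 v] by simp
  then show ?thesis using cos_ge_minus_one[of a] by linarith
qed

lemma continuous_on_cosh_integrand: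
  "v > 0 \<Longrightarrow> continuous_on S (\<lambda>t. (cosh v + cos (2 * pi * t)) powr s)"
  by (intro continuous_on_powr continuous_intros) (metis cosh_base_pos less_irrefl)

lemma cosh_integrand_integrable:
  "v > 0 \<Longrightarrow> (\<lambda>t. (cosh v + cos (2 * pi * t)) powr s) integrable_on {0..1}"
  by (intro integrable_continuous_interval continuous_on_cosh_integrand)

lemma cosh_integral_pos: "v > 0 \<Longrightarrow> cosh_integral s v > 0"
  unfolding cosh_integral_def
  using cosh_base_pos[of v 0]
  by (intro integral_pos_if_pos_at_point[where s = 0] continuous_on_cosh_integrand) auto

lemma has_real_derivative_cosh_integral:
  assumes "v > 0"
  shows "(cosh_integral s has_real_derivative s * sinh v * cosh_integral (s - 1) v) (at v)"
proof -
  let ?f = "\<lambda>v t. (cosh v + cos (2 * pi * t)) powr s"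
  let ?fx = "\<lambda>v t. s * sinh v * (cosh v + cos (2 * pi * t)) powr (s - 1)"
  \<comment> \<open>On the half-line \<open>{0<..}\<close> the base \<open>cosh v + cos\<close>
    stays positive, so differentiation under the integral is legitimate for every real exponent; at
    \<open>v = 0\<close> the base vanishes for \<open>t = 1/2\<close>.\<close>
  have "((\<lambda>v. integral (cbox 0 1) (?f v)) has_field_derivative integral (cbox 0 1) (?fx v)) (at v within {0<..})"
  proof (rule leibniz_rule_field_derivative)
    fix x t :: real assume x: "x \<in> {0<..}"
    have p: "cosh x + cos (2 * pi * t) > 0" using cosh_base_pos x by simp
    have "((\<lambda>x. cosh x + cos (2 * pi * t)) has_real_derivative sinh x) (at x)"
      by (auto intro!: derivative_eq_intros)
    from has_field_derivative_at_within[OF DERIV_fun_powr[OF this p, of s]]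
    show "((\<lambda>x. ?f x t) has_real_derivative ?fx x t) (at x within {0<..})"
      by (simp add: mult_ac)
    show "?f x integrable_on cbox 0 1" using cosh_integrand_integrable x by simp
  next
    show "continuous_on ({0<..} \<times> cbox 0 1) (\<lambda>(x, t). ?fx x t)"
    proof (unfold split_beta, intro continuous_on_mult continuous_on_powr)
      show "\<forall>z\<in>{0<..} \<times> cbox 0 1. cosh (fst z) + cos (2 * pi * snd z) \<noteq> 0"
      proof
        fix z :: "real \<times> real" assume "z \<in> {0<..} \<times> cbox 0 1"
        then show "cosh (fst z) + cos (2 * pi * snd z) \<noteq> 0"
          using cosh_base_pos[of "fst z" "2 * pi * snd z"] by auto
      qed
    qed (intro continuous_intros)+
    show "v \<in> {0<..}" using assms by simp
    show "convex {0::real<..}" by simp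
  qed
  moreover have "at v within {0<..} = at v"
    using assms by (intro at_within_open) auto
  ultimately have "((\<lambda>v. integral (cbox 0 1) (?f v)) has_field_derivative integral (cbox 0 1) (?fx v)) (at v)"
    by simp
  moreover have "integral (cbox 0 1) (?fx v) = s * sinh v * cosh_integral (s - 1) v"
    unfolding cosh_integral_def by simp
  ultimately show ?thesis unfolding cosh_integral_def[abs_def] by simp
qed

text \<open>Integration by parts in disguise: the derivative in \<open>t\<close> of C^(s-1) sin,
  with C = cosh v + cos, has integral 0 over a period. Writing sin^2 as 1 - cos^2 and the cosine as
  C - cosh v turns that derivative into a combination of three consecutive powers of C.\<close>

lemma cosh_integral_recurrence:
  assumes v: "v > 0"
  shows "(s - 1) * (sinh v)\<^sup>2 * cosh_integral (s - 2) v =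
    (2 * s - 1) * cosh v * cosh_integral (s - 1) v - s * cosh_integral s v"
proof -
  let ?C = "\<lambda>t. cosh v + cos (2 * pi * t)"
  have p: "?C t > 0" for t using cosh_base_pos[OF v] by simp
  have ii: "((\<lambda>t. ?C t powr a) has_integral cosh_integral a v) {0..1}" for a
    unfolding cosh_integral_def using cosh_integrand_integrable[OF v] by (simp add: integrable_integral)
  let ?g = "\<lambda>t. ?C t powr (s - 1) * sin (2 * pi * t) / (2 * pi)"
  let ?h = "\<lambda>t. (s - 1) * (sinh v)\<^sup>2 * ?C t powr (s - 2) - (2 * s - 1) * cosh v * ?C t powr (s - 1) + s * ?C t powr s"
  have "(?h has_integral (?g 1 - ?g 0)) {0..1}"
  proof (rule fundamental_theorem_of_calculus)
    fix t :: real
    have e: "?C t powr (1 + b) = ?C t * ?C t powr b" for b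
      using p[of t] by (simp only: powr_add powr_one less_imp_le)
    have e1: "?C t powr (s - 1) = ?C t * ?C t powr (s - 2)" "?C t powr s = ?C t * (?C t * ?C t powr (s - 2))"
      using e[of "s - 2"] e[of "s - 1"] by auto
    let ?c = "cos (2 * pi * t)" and ?P = "?C t powr (s - 2)"
    have dC: "(?C has_real_derivative - (sin (2 * pi * t) * (2 * pi))) (at t)"
      and dS: "((\<lambda>t. sin (2 * pi * t)) has_real_derivative ?c * (2 * pi)) (at t)"
      by (auto intro!: derivative_eq_intros)
    have "(?g has_real_derivative (?C t powr (s - 1) * ?c - (s - 1) * (sin (2 * pi * t))\<^sup>2 * ?P)) (at t)"
      by (rule DERIV_cong[OF DERIV_cdivide[OF DERIV_mult[OF DERIV_fun_powr[OF dC p, of "s - 1"] dS]]])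
        (simp add: power2_eq_square diff_divide_distrib)
    moreover have "?C t powr (s - 1) * ?c - (s - 1) * (sin (2 * pi * t))\<^sup>2 * ?P = ?h t"
    proof -
      have s2: "(sin (2 * pi * t))\<^sup>2 = 1 - ?c\<^sup>2" by (rule sin_squared_eq)
      have sh: "(sinh v)\<^sup>2 = (cosh v)\<^sup>2 - 1" by (rule sinh_square_eq)
      have "(h + c) * P * c - (s - 1) * (1 - c\<^sup>2) * P =
          (s - 1) * (h\<^sup>2 - 1) * P - (2 * s - 1) * h * ((h + c) * P) + s * ((h + c) * ((h + c) * P))" for h c P :: real
        by (simp add: algebra_simps power2_eq_square)
      then show ?thesis unfolding s2 sh e1 .
    qed
    ultimately show "(?g has_vector_derivative ?h t) (at t within {0..1})"
      by (simp add: has_real_derivative_iff_has_vector_derivative[symmetric] has_field_derivative_at_within)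
  qed simp
  then have "(?h has_integral 0) {0..1}" by simp
  moreover have "(?h has_integral ((s - 1) * (sinh v)\<^sup>2 * cosh_integral (s - 2) v
      - (2 * s - 1) * cosh v * cosh_integral (s - 1) v + s * cosh_integral s v)) {0..1}"
    by (rule has_integral_add[OF has_integral_diff[OF has_integral_mult_right[OF ii]
          has_integral_mult_right[OF ii]] has_integral_mult_right[OF ii]])
  ultimately have "(s - 1) * (sinh v)\<^sup>2 * cosh_integral (s - 2) v
      - (2 * s - 1) * cosh v * cosh_integral (s - 1) v + s * cosh_integral s v = 0"
    by (rule has_integral_unique[rotated])
  then show ?thesis by linarith
qed

text \<open>\<open>r * cosh_log_deriv r\<close> is the logarithmic derivative of \<open>cosh_integral r\<close>, for which the
  recurrence above becomes a Riccati equation.\<close>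

definition cosh_log_deriv :: "real \<Rightarrow> real \<Rightarrow> real" where
  "cosh_log_deriv r v = sinh v * cosh_integral (r - 1) v / cosh_integral r v"

lemma has_real_derivative_cosh_log_deriv:
  fixes r v :: real
  assumes v: "v > 0"
  defines "W \<equiv> cosh_log_deriv r v"
  shows "(cosh_log_deriv r has_real_derivative
    (2 * r * (cosh v / sinh v) * W - r * (1 + W\<^sup>2))) (at v)"
proof -
  let ?A = "\<lambda>k. cosh_integral (r - k) v"
  have p: "?A 0 > 0" using cosh_integral_pos[OF v] .
  have d: "(cosh_log_deriv r has_real_derivative
      ((cosh v * ?A 1 + sinh v * ((r - 1) * sinh v * ?A 2)) * ?A 0 - sinh v * ?A 1 * (r * sinh v * ?A 1)) / (?A 0 * ?A 0)) (at v)"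
    unfolding cosh_log_deriv_def[abs_def]
    using p has_real_derivative_cosh_integral[OF v, of "r - 1"] has_real_derivative_cosh_integral[OF v, of r]
    by (auto intro!: derivative_eq_intros simp: algebra_simps)
  \<comment> \<open>The recurrence eliminates \<open>?A 2\<close>, so that the derivative closes up
    in terms of the quotient itself.\<close>
  have h: "cosh v * ?A 1 + sinh v * ((r - 1) * sinh v * ?A 2) = 2 * r * cosh v * ?A 1 - r * ?A 0"
    using cosh_integral_recurrence[OF v, of r] by (simp add: algebra_simps power2_eq_square)
  have alg: "((2 * r * c * A1 - r * A0) * A0 - S * A1 * (r * S * A1)) / (A0 * A0) =
      2 * r * (c / S) * (S * A1 / A0) - r * (1 + (S * A1 / A0)\<^sup>2)" if "A0 \<noteq> 0" "S \<noteq> 0" for c S A0 A1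
    using that by (simp add: field_simps power2_eq_square)
  have "sinh v \<noteq> 0" "?A 0 \<noteq> 0" using p v by auto
  from d[unfolded h alg[OF this(2,1)]] show ?thesis
    unfolding W_def cosh_log_deriv_def[of r v] by (simp only: diff_zero)
qed

lemma cos_integral_exp:
  assumes "v > 0"
  shows "cos_integral r (exp (- v)) = (2 * exp (- v)) powr r * cosh_integral r v"
proof -
  have "(1 + (exp (- v))\<^sup>2 + 2 * exp (- v) * cos (2 * pi * t)) powr r =
      (2 * exp (- v)) powr r * (cosh v + cos (2 * pi * t)) powr r" for t
  proof -
    have "1 + (exp (- v))\<^sup>2 + 2 * exp (- v) * cos (2 * pi * t) = (2 * exp (- v)) * (cosh v + cos (2 * pi * t))"
      by (simp add: cosh_field_def algebra_simps power2_eq_square exp_minus)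
    then show ?thesis using cosh_base_pos[OF assms, of "2 * pi * t"] by (simp only:) (intro powr_mult; simp)
  qed
  then show ?thesis unfolding cos_integral_def cosh_integral_def by simp
qed

text \<open>At a critical point of the logarithmic gap the Riccati unknown equals
  \<open>tanh (a * v)\<close>; the left-hand side is the second derivative of the gap there, divided
  by \<open>r\<close>. With the factor 1 / cosh^2 taken out, the addition formulas leave an
  expression whose sign depends on a monotone ratio of hyperbolic sines.\<close>

lemma log_gap_second_derivative_at_critical:
  fixes a r v :: real
  assumes v: "v > 0"
  shows "a * (1 - (tanh (a * v))\<^sup>2) - (2 * r * (cosh v / sinh v) * tanh (a * v) - r * (1 + (tanh (a * v))\<^sup>2))
    = (a - r * (sinh ((2 * a - 1) * v) / sinh v)) / (cosh (a * v))\<^sup>2"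
proof -
  have c: "cosh (a * v) > 0" "sinh v > 0" using v by simp_all
  have "sinh ((2 * a - 1) * v) = sinh (a * v + a * v - v)" by (simp add: algebra_simps)
  also have "\<dots> = 2 * sinh (a * v) * cosh (a * v) * cosh v - ((cosh (a * v))\<^sup>2 + (sinh (a * v))\<^sup>2) * sinh v"
    by (simp only: sinh_diff sinh_add cosh_add) (simp add: algebra_simps power2_eq_square)
  finally have s: "sinh ((2 * a - 1) * v) = \<dots>" .
  have "(cosh (a * v))\<^sup>2 - (sinh (a * v))\<^sup>2 = 1" by (simp add: cosh_square_eq)
  then have t: "1 - (tanh (a * v))\<^sup>2 = 1 / (cosh (a * v))\<^sup>2"
    using c by (simp add: tanh_def power_divide diff_divide_eq_iff)
  have "a * (1 / C\<^sup>2) - (2 * r * (k / l) * (S / C) - r * (1 + (S / C)\<^sup>2)) =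
      (a - r * ((2 * S * C * k - (C\<^sup>2 + S\<^sup>2) * l) / l)) / C\<^sup>2" if "C \<noteq> 0" "l \<noteq> 0" for C S k l
    using that by (simp add: field_simps power2_eq_square)
  from this[of "cosh (a * v)" "sinh v" "cosh v" "sinh (a * v)"] show ?thesis
    unfolding t s using c by (simp only: tanh_def)
qed

text \<open>In terms of the exponents, \<open>r\<close> is q/2 and \<open>a\<close> is p/2; the
  hypothesis \<open>end1\<close> says that \<open>p\<close> is critical, i.e. that equality holds at
  \<open>x = 1\<close>.\<close>

lemma cos_integral_le:
  assumes r: "r \<ge> 1" and a: "1 / 2 < a" "a < 1"
    and end1: "cos_integral r 1 = 2 powr (r / a)" and x: "0 \<le> x" "x \<le> 1"
  shows "cos_integral r x \<le> (1 + x powr (2 * a)) powr (r / a)"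
proof -
  \<comment> \<open>\<open>D\<close> is the logarithmic gap between the two sides; it vanishes at 0
    and at 1.\<close>
  define D where "D x = (r / a) * ln (1 + x powr (2 * a)) - ln (cos_integral r x)" for x
  have r0: "r > 0" using r by simp
  have pI: "cos_integral r x > 0" if "x \<ge> 0" for x using cos_integral_pos[OF r0 that] .
  have p1: "1 + x powr (2 * a) > 0" for x by (simp add: add_pos_nonneg)
  have cD: "continuous_on {0..} D"
    unfolding D_def using pI p1 a
    by (intro continuous_intros continuous_on_cos_integral[OF r0] continuous_on_powr') (auto simp: less_imp_neq[symmetric])
  have D0: "D 0 = 0" and D1: "D 1 = 0" using a end1 by (simp_all add: D_def cos_integral_0 ln_powr)
  \<comment> \<open>Near 0 the right-hand side gains a multiple of x^(2a), while
    \<open>cos_integral\<close> gains at most \<open>C * x\<^sup>2\<close>. As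
    \<open>2 * a < 2\<close>, the former wins once
    \<open>C * x powr (2 - 2 * a) < 1\<close>.\<close>
  have Dpos: "\<exists>d. 0 < d \<and> d < x0 \<and> D d > 0" if "x0 > 0" for x0
  proof -
    define C where "C = r + 9 * r\<^sup>2"
    have C: "C > 0" using r by (simp add: C_def add_pos_pos)
    have "((\<lambda>x. C * x powr (2 - 2 * a)) \<longlongrightarrow> C * 0 powr (2 - 2 * a)) (at_right 0)"
      using a by (intro tendsto_intros tendsto_powr') (auto simp: eventually_at_filter)
    then have "eventually (\<lambda>x. C * x powr (2 - 2 * a) < 1) (at_right 0)"
      using order_tendstoD(2)[of "\<lambda>x. C * x powr (2 - 2 * a)" 0 "at_right 0" 1] a by simp
    moreover have "eventually (\<lambda>x. 0 < x \<and> x < min (min x0 1) (1 / (3 * r))) (at_right (0::real))"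
      using that r0 by (intro eventually_at_rightI[of 0 "min (min x0 1) (1 / (3 * r))"]) auto
    ultimately have "eventually (\<lambda>x. C * x powr (2 - 2 * a) < 1 \<and> 0 < x \<and> x < min (min x0 1) (1 / (3 * r))) (at_right 0)"
      by eventually_elim simp
    then obtain d where d: "C * d powr (2 - 2 * a) < 1" "0 < d" "d < x0" "d < 1" "d < 1 / (3 * r)"
      by (metis (no_types, lifting) eventually_happens min_less_iff_conj trivial_limit_at_right_real)
    have "cos_integral r d \<le> 1 + C * d\<^sup>2"
      unfolding C_def using d r by (intro cos_integral_le_near_0) (auto simp: field_simps)
    also have "d\<^sup>2 = d powr (2 - 2 * a) * d powr (2 * a)"
      using d by (simp add: powr_add[symmetric])
    also have "1 + C * \<dots> < 1 + 1 * d powr (2 * a)"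
      using d by (simp add: mult.assoc[symmetric])
    finally have "cos_integral r d < 1 + d powr (2 * a)" by simp
    then have "ln (cos_integral r d) < ln (1 + d powr (2 * a))"
      using pI[of d] d by simp
    also have "\<dots> \<le> (r / a) * ln (1 + d powr (2 * a))"
    proof -
      have "1 \<le> r / a" using r a by simp
      moreover have "ln (1 + d powr (2 * a)) \<ge> 0" by simp
      ultimately show ?thesis using mult_right_mono[of 1 "r / a" "ln (1 + d powr (2 * a))"] by linarith
    qed
    finally have "D d > 0" unfolding D_def by simp
    then show ?thesis using d(2,3) by blast
  qed
  have nonneg: "D x \<ge> 0"
  proof (rule ccontr)
    assume neg: "\<not> D x \<ge> 0"
    then have "x \<noteq> 0" "x \<noteq> 1" using D0 D1 by auto
    then have x': "0 < x" "x < 1" using x by simp_all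
    obtain d where d: "0 < d" "d < x" "D d > 0" using Dpos x' by blast
    \<comment> \<open>The gap is 0 at 0, positive somewhere before \<open>x\<close>, negative at
      \<open>x\<close> and 0 at 1. This forces an interior maximum \<open>x1\<close> to the left of
      \<open>x\<close> and then an interior minimum \<open>x0\<close> between \<open>x1\<close> and
      1. The substitution x = exp (- v) reverses their order.\<close>
    obtain x1 where x1: "x1 \<in> {0..x}" "\<And>y. y \<in> {0..x} \<Longrightarrow> D y \<le> D x1"
      using continuous_attains_sup[of "{0..x}" D] continuous_on_subset[OF cD] x by auto
    have "D x1 > 0" using x1(2)[of d] d by auto
    then have "x1 \<noteq> 0" "x1 \<noteq> x" using D0 neg by auto
    then have x1': "0 < x1" "x1 < x" using x1(1) by simp_all
    obtain x0 where x0: "x0 \<in> {x1..1}" "\<And>y. y \<in> {x1..1} \<Longrightarrow> D x0 \<le> D y"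
      using continuous_attains_inf[of "{x1..1}" D] continuous_on_subset[OF cD, of "{x1..1}"] x1' x' by auto
    have "D x0 < 0" using x0(2)[of x] neg x1' x' by auto
    then have "x0 \<noteq> x1" "x0 \<noteq> 1" using D1 \<open>D x1 > 0\<close> by auto
    then have x0': "x1 < x0" "x0 < 1" using x0(1) by simp_all
    define G where "G v = D (exp (- v))" for v
    \<comment> \<open>The hyperbolic tangent comes from
      \<open>(r / a) * ln (1 + exp (- (2 * a * v)))\<close> together with the term
      \<open>r * v\<close> contributed by the factor \<open>(2 * exp (- v)) powr r\<close> of
      \<open>cos_integral_exp\<close>.\<close>
    define G' where "G' v = r * (tanh (a * v) - cosh_log_deriv r v)" for v
    define G'' where "G'' v = r * (a * (1 - (tanh (a * v))\<^sup>2) - (2 * r * (cosh v / sinh v) * cosh_log_deriv r v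
        - r * (1 + (cosh_log_deriv r v)\<^sup>2)))" for v
    have G: "(G has_real_derivative G' v) (at v)" if v: "v > 0" for v
    proof -
      have Geq: "G w = (r / a) * ln (1 + exp (- (2 * a * w))) - (r * (ln 2 - w) + ln (cosh_integral r w))" if "w > 0" for w
      proof -
        have "exp (- w) powr (2 * a) = exp (- (2 * a * w))" by (simp add: powr_def)
        moreover have "ln (2 * exp (- w)) = ln 2 - w" by (simp add: ln_mult)
        then have "ln (cos_integral r (exp (- w))) = r * (ln 2 - w) + ln (cosh_integral r w)"
          using cosh_integral_pos[OF that, of r] unfolding cos_integral_exp[OF that]
          by (subst ln_mult_pos) (auto simp: ln_powr)
        ultimately show ?thesis unfolding G_def D_def by simp
      qed
      have "((\<lambda>w. (r / a) * ln (1 + exp (- (2 * a * w))) - (r * (ln 2 - w) + ln (cosh_integral r w)))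
          has_real_derivative G' v) (at v)"
      proof -
        have p: "1 + exp (- (2 * a * v)) > 0" by (simp add: add_pos_pos)
        have th: "tanh (a * v) = 1 - 2 * exp (- (2 * a * v)) / (1 + exp (- (2 * a * v)))"
          using p by (simp add: tanh_real_altdef field_simps)
        have "((\<lambda>w. ln (1 + exp (- (2 * a * w)))) has_real_derivative
            - (2 * a) * exp (- (2 * a * v)) / (1 + exp (- (2 * a * v)))) (at v)"
          using p by (auto intro!: derivative_eq_intros)
        from DERIV_cmult[OF this, of "r / a"]
        have d1: "((\<lambda>w. (r / a) * ln (1 + exp (- (2 * a * w)))) has_real_derivative
            - (r * (2 * exp (- (2 * a * v)) / (1 + exp (- (2 * a * v)))))) (at v)"
          by (rule DERIV_cong) (use a in simp)
        have "((\<lambda>w. ln (cosh_integral r w)) has_real_derivative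
            1 / cosh_integral r v * (r * sinh v * cosh_integral (r - 1) v)) (at v)"
          by (rule DERIV_ln_divide[THEN DERIV_chain2]) (use has_real_derivative_cosh_integral[OF v] cosh_integral_pos[OF v] in auto)
        moreover have "((\<lambda>w. r * (ln 2 - w)) has_real_derivative - r) (at v)"
          by (auto intro!: derivative_eq_intros)
        ultimately have d2: "((\<lambda>w. r * (ln 2 - w) + ln (cosh_integral r w)) has_real_derivative
            - r + 1 / cosh_integral r v * (r * sinh v * cosh_integral (r - 1) v)) (at v)"
          using DERIV_add by blast
        show ?thesis unfolding G'_def th cosh_log_deriv_def
          by (rule DERIV_cong[OF DERIV_diff[OF d1 d2]]) (simp add: right_diff_distrib)
      qed
      then show ?thesis
        by (rule has_field_derivative_transform_within_open[where S = "{0<..}"]) (use v Geq in auto)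
    qed
    have G2: "(G' has_real_derivative G'' v) (at v)" if v: "v > 0" for v
    proof -
      have "((\<lambda>v. tanh (a * v)) has_real_derivative (1 - (tanh (a * v))\<^sup>2) * a) (at v)"
        by (auto intro!: derivative_eq_intros)
      then show ?thesis unfolding G'_def[abs_def] G''_def
        by (rule DERIV_cong[OF DERIV_cmult[OF DERIV_diff[OF _ has_real_derivative_cosh_log_deriv[OF v]]]])
          (simp add: mult.commute)
    qed
    have G''crit: "G'' v = r * ((a - r * (sinh ((2 * a - 1) * v) / sinh v)) / (cosh (a * v))\<^sup>2)" if "v > 0" "G' v = 0" for v
    proof -
      have "cosh_log_deriv r v = tanh (a * v)" using that r by (simp add: G'_def)
      then show ?thesis unfolding G''_def by (simp only: log_gap_second_derivative_at_critical[OF that(1)])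
    qed
    define v0 v1 where "v0 = - ln x0" and "v1 = - ln x1"
    have v: "0 < v0" "v0 < v1" using x0' x1' by (auto simp: v0_def v1_def)
    have e: "exp (- v0) = x0" "exp (- v1) = x1" using x0' x1' by (auto simp: v0_def v1_def)
    \<comment> \<open>This window keeps \<open>y\<close> between 0 and \<open>v1\<close>, so that
      \<open>exp (- y)\<close> stays in \<open>{x1..1}\<close>, where \<open>x0\<close> is the
      minimum.\<close>
    have min: "G v0 \<le> G y" if "\<bar>y - v0\<bar> < min v0 (v1 - v0)" for y
    proof -
      have "0 < y" "y < v1" using that by auto
      then have "exp (- y) \<in> {x1..1}" using e by (auto simp flip: e(2))
      then show ?thesis using x0 e by (simp add: G_def)
    qed
    have "G' v0 = 0" "G'' v0 \<ge> 0"
    proof -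
      have der: "(G has_real_derivative G' y) (at y)" if "\<bar>y - v0\<bar> < min v0 (v1 - v0)" for y
        by (rule G) (use that in linarith)
      have pos: "min v0 (v1 - v0) > 0" using v by simp
      show "G' v0 = 0" "G'' v0 \<ge> 0"
        using second_deriv_nonneg_at_local_min[OF pos der G2[OF v(1)] min] by blast+
    qed
    then have k0: "a - r * (sinh ((2 * a - 1) * v0) / sinh v0) \<ge> 0"
      using G''crit[of v0] v r0 by (simp add: zero_le_mult_iff zero_le_divide_iff)
    \<comment> \<open>The radius is the distance from \<open>v1\<close> to \<open>- ln x\<close>, so
      \<open>exp (- y)\<close> stays in \<open>{0..x}\<close>. The maximum is treated as a minimum
      of \<open>- G\<close>.\<close>
    have max: "- G v1 \<le> - G y" if "\<bar>y - v1\<bar> < v1 + ln x" for y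
    proof -
      have "y > - ln x" using that by auto
      then have "exp (- y) \<le> x" using x' exp_le_cancel_iff[of "- y" "ln x"] by simp
      then have "exp (- y) \<in> {0..x}" by simp
      then show ?thesis using x1 e by (simp add: G_def)
    qed
    have "- G' v1 = 0" "- G'' v1 \<ge> 0"
    proof -
      have xv: "v1 + ln x > 0" "v1 > 0" "ln x < 0" using x1' x' v by (auto simp: v1_def)
      have der: "((\<lambda>y. - G y) has_real_derivative - G' y) (at y)" if "\<bar>y - v1\<bar> < v1 + ln x" for y
        by (rule G[THEN DERIV_minus]) (use that xv in linarith)
      show "- G' v1 = 0" "- G'' v1 \<ge> 0"
        using second_deriv_nonneg_at_local_min[OF xv(1) der G2[OF xv(2), THEN DERIV_minus] max] by blast+
    qed
    then have k1: "a - r * (sinh ((2 * a - 1) * v1) / sinh v1) \<le> 0"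
      using G''crit[of v1] v r0 by (simp add: mult_le_0_iff divide_le_0_iff)
    \<comment> \<open>By \<open>k0\<close> and \<open>k1\<close> the right-hand side is at most
      \<open>a\<close> and the left-hand side at least \<open>a\<close>, which strict decrease from
      \<open>v0\<close> to \<open>v1\<close> excludes.\<close>
    have "r * (sinh ((2 * a - 1) * v1) / sinh v1) < r * (sinh ((2 * a - 1) * v0) / sinh v0)"
      by (intro mult_strict_left_mono sinh_ratio_strict_decreasing) (use v a r0 in auto)
    with k0 k1 show False by linarith
  qed
  then have "ln (cos_integral r x) \<le> ln ((1 + x powr (2 * a)) powr (r / a))"
    using p1[of x] by (simp add: D_def ln_powr)
  moreover have "(1 + x powr (2 * a)) powr (r / a) > 0" using p1[of x] by simp
  ultimately show ?thesis using pI[OF x(1)] ln_le_cancel_iff by blast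
qed

section \<open>The two-point inequality\<close>

lemma Gamma_legendre_duplication_real:
  fixes z :: real
  assumes "z > 0"
  shows "Gamma z * Gamma (z + 1 / 2) = 2 powr (1 - 2 * z) * sqrt pi * Gamma (2 * z)"
proof -
  have nz: "complex_of_real x \<notin> \<int>\<^sub>\<le>\<^sub>0" if "x > 0" for x
    using that nonpos_Ints_nonpos[of x] by (auto simp: of_real_in_nonpos_Ints_iff)
  have "complex_of_real z + 1 / 2 = complex_of_real (z + 1 / 2)" "2 * complex_of_real z = complex_of_real (2 * z)"
    by simp_all
  then have "complex_of_real (Gamma z * Gamma (z + 1 / 2)) =
      exp ((1 - 2 * complex_of_real z) * of_real (ln 2)) * of_real (sqrt pi) * of_real (Gamma (2 * z))"
    using Gamma_legendre_duplication[of "complex_of_real z"] nz[of z] nz[of "z + 1 / 2"] assms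
    by (simp only: of_real_mult Gamma_complex_of_real[symmetric]) simp
  also have "exp ((1 - 2 * complex_of_real z) * of_real (ln 2)) = of_real (2 powr (1 - 2 * z))"
    by (simp add: powr_def flip: exp_of_real)
  finally show ?thesis by (simp only: of_real_mult[symmetric] of_real_eq_iff)
qed

text \<open>The substitution u = cos^2 (pi t) on one injective branch \<open>S\<close> yields the
  Beta integral: the Jacobian 2 pi |cos sin| cancels the half powers of u and 1 - u.\<close>

lemma has_integral_cos_power:
  assumes r: "r > 0" and S: "S \<in> sets lebesgue" and inj: "inj_on (\<lambda>t. (cos (pi * t))\<^sup>2) S"
    and im: "(\<lambda>t. (cos (pi * t))\<^sup>2) ` S = {0<..<1}"
  shows "((\<lambda>t. (4 * (cos (pi * t))\<^sup>2) powr r) has_integral (4 powr r * Beta (r + 1 / 2) (1 / 2) / (2 * pi))) S"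
proof -
  let ?g = "\<lambda>t. (cos (pi * t))\<^sup>2" and ?g' = "\<lambda>t. - (2 * pi * cos (pi * t) * sin (pi * t))"
  let ?f = "\<lambda>u. u powr (r + 1 / 2 - 1) * (1 - u) powr (1 / 2 - 1)"
  have hB: "(?f has_integral Beta (r + 1 / 2) (1 / 2)) {0<..<1}"
    using has_integral_Beta_real[of "r + 1 / 2" "1 / 2"] r by (simp add: has_integral_Icc_iff_Ioo)
  have "?f absolutely_integrable_on {0<..<1}"
    using hB by (intro nonnegative_absolutely_integrable_1) (auto simp: integrable_on_def)
  then have "(\<lambda>t. \<bar>?g' t\<bar> * ?f (?g t)) absolutely_integrable_on S \<and>
      integral S (\<lambda>t. \<bar>?g' t\<bar> * ?f (?g t)) = Beta (r + 1 / 2) (1 / 2)"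
    using integral_unique[OF hB]
    by (subst has_absolute_integral_change_of_variables_1'[OF S _ inj])
      (auto intro!: derivative_eq_intros simp: im simp del: diff_add_eq)
  then have "((\<lambda>t. \<bar>?g' t\<bar> * ?f (?g t)) has_integral Beta (r + 1 / 2) (1 / 2)) S"
    using integrable_integral[OF set_lebesgue_integral_eq_integral(1)] by fastforce
  then have "((\<lambda>t. 4 powr r / (2 * pi) * (\<bar>?g' t\<bar> * ?f (?g t))) has_integral
      4 powr r / (2 * pi) * Beta (r + 1 / 2) (1 / 2)) S"
    by (rule has_integral_mult_right)
  moreover have "4 powr r / (2 * pi) * (\<bar>?g' t\<bar> * ?f (?g t)) = (4 * (cos (pi * t))\<^sup>2) powr r" if "t \<in> S" for t
  proof -
    have "?g t \<in> {0<..<1}" using im that by blast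
    then have c: "cos (pi * t) \<noteq> 0" and s: "sin (pi * t) \<noteq> 0"
      using sin_squared_eq[of "pi * t"] by auto
    have "1 - ?g t = (sin (pi * t))\<^sup>2" by (simp add: sin_squared_eq)
    then have "(1 - ?g t) powr (1 / 2 - 1) = ((sin (pi * t))\<^sup>2) powr (- (1 / 2))" by simp
    also have "\<dots> = 1 / \<bar>sin (pi * t)\<bar>"
      by (simp add: powr_minus powr_half_sqrt field_simps)
    finally have a: "(1 - ?g t) powr (1 / 2 - 1) = 1 / \<bar>sin (pi * t)\<bar>" .
    have "?g t powr (r + 1 / 2 - 1) = ?g t powr r * ?g t powr (- (1 / 2))"
      by (simp add: powr_add[symmetric])
    also have "?g t powr (- (1 / 2)) = 1 / \<bar>cos (pi * t)\<bar>"
      by (simp add: powr_minus powr_half_sqrt field_simps)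
    finally have b: "?g t powr (r + 1 / 2 - 1) = ?g t powr r * (1 / \<bar>cos (pi * t)\<bar>)" .
    show ?thesis unfolding a b using c s by (simp add: abs_mult powr_mult)
  qed
  ultimately have "((\<lambda>t. (4 * (cos (pi * t))\<^sup>2) powr r) has_integral
      4 powr r / (2 * pi) * Beta (r + 1 / 2) (1 / 2)) S"
    by (rule has_integral_eq[rotated])
  then show ?thesis by simp
qed

lemma cos_squared_bij:
  shows "inj_on (\<lambda>t. (cos (pi * t))\<^sup>2) {0<..<1/2}" "(\<lambda>t. (cos (pi * t))\<^sup>2) ` {0<..<1/2} = {0<..<1}"
    and "inj_on (\<lambda>t. (cos (pi * t))\<^sup>2) {1/2<..<1}" "(\<lambda>t. (cos (pi * t))\<^sup>2) ` {1/2<..<1} = {0<..<1}"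
proof -
  have pos: "cos (pi * t) > 0" if "t \<in> {0<..<1/2}" for t
  proof (rule cos_gt_zero_pi)
    have "0 < pi * t" "pi * t < pi * (1 / 2)"
      using that by (auto simp del: mult_less_cancel_left_pos intro!: mult_strict_left_mono)
    then show "- (pi / 2) < pi * t" "pi * t < pi / 2" using pi_gt_zero by linarith+
  qed
  have neg: "cos (pi * t) < 0" if "t \<in> {1/2<..<1}" for t
  proof -
    have "cos (pi * (1 - t)) > 0" using that by (intro pos) auto
    then show ?thesis by (simp add: right_diff_distrib cos_diff)
  qed
  have inj: "s = t" if "cos (pi * s) = cos (pi * t)" "s \<in> {0..1}" "t \<in> {0..1}" for s t
    using cos_inj_pi[of "pi * s" "pi * t"] that by (simp add: mult_left_le)
  show "inj_on (\<lambda>t. (cos (pi * t))\<^sup>2) {0<..<1/2}"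
  proof (intro inj_onI)
    fix s t :: real assume h: "s \<in> {0<..<1/2}" "t \<in> {0<..<1/2}" "(cos (pi * s))\<^sup>2 = (cos (pi * t))\<^sup>2"
    then have "cos (pi * s) = cos (pi * t)" using pos[of s] pos[of t] by (auto simp: power2_eq_iff)
    then show "s = t" by (rule inj) (use h(1,2) in simp_all)
  qed
  show "inj_on (\<lambda>t. (cos (pi * t))\<^sup>2) {1/2<..<1}"
  proof (intro inj_onI)
    fix s t :: real assume h: "s \<in> {1/2<..<1}" "t \<in> {1/2<..<1}" "(cos (pi * s))\<^sup>2 = (cos (pi * t))\<^sup>2"
    then have "cos (pi * s) = cos (pi * t)" using neg[of s] neg[of t] by (auto simp: power2_eq_iff)
    then show "s = t" by (rule inj) (use h(1,2) in simp_all)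
  qed
  have 1: "(cos (pi * t))\<^sup>2 \<in> {0<..<1}" if "t \<in> {0<..<1}" "cos (pi * t) \<noteq> 0" for t
  proof -
    have "sin (pi * t) > 0" using that by (intro sin_gt_zero) auto
    then have "(sin (pi * t))\<^sup>2 > 0" by simp
    then show ?thesis using that by (simp add: sin_squared_eq)
  qed
  have ex: "\<exists>t\<in>{0<..<1/2}. u = (cos (pi * t))\<^sup>2" if "u \<in> {0<..<1}" for u
  proof -
    define t where "t = arccos (sqrt u) / pi"
    have u: "0 < sqrt u" "sqrt u < 1" using that by auto
    have "arccos (sqrt u) > 0" using arccos_less_arccos[of "sqrt u" 1] u by simp
    moreover have "arccos (sqrt u) < pi / 2" using arccos_less_arccos[of 0 "sqrt u"] u by simp
    moreover have "cos (pi * t) = sqrt u"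
    proof -
      have "- 1 \<le> sqrt u" "sqrt u \<le> 1" using u by linarith+
      then show ?thesis using cos_arccos[of "sqrt u"] by (simp add: t_def)
    qed
    ultimately show ?thesis using that by (intro bexI[of _ t]) (auto simp: t_def field_simps)
  qed
  show "(\<lambda>t. (cos (pi * t))\<^sup>2) ` {0<..<1/2} = {0<..<1}"
  proof
    show "(\<lambda>t. (cos (pi * t))\<^sup>2) ` {0<..<1/2} \<subseteq> {0<..<1}"
    proof (rule image_subsetI)
      fix t :: real assume "t \<in> {0<..<1/2}"
      then show "(cos (pi * t))\<^sup>2 \<in> {0<..<1}" using pos[of t] by (intro 1) auto
    qed
  qed (use ex in blast)
  show "(\<lambda>t. (cos (pi * t))\<^sup>2) ` {1/2<..<1} = {0<..<1}"
  proof
    show "(\<lambda>t. (cos (pi * t))\<^sup>2) ` {1/2<..<1} \<subseteq> {0<..<1}"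
    proof (rule image_subsetI)
      fix t :: real assume "t \<in> {1/2<..<1}"
      then show "(cos (pi * t))\<^sup>2 \<in> {0<..<1}" using neg[of t] by (intro 1) auto
    qed
    show "{0<..<1} \<subseteq> (\<lambda>t. (cos (pi * t))\<^sup>2) ` {1/2<..<1}"
    proof
      fix u :: real assume "u \<in> {0<..<1}"
      then obtain t where t: "t \<in> {0<..<1/2}" "u = (cos (pi * t))\<^sup>2" using ex by blast
      then have "u = (cos (pi * (1 - t)))\<^sup>2" by (simp add: right_diff_distrib cos_diff)
      then show "u \<in> (\<lambda>t. (cos (pi * t))\<^sup>2) ` {1/2<..<1}" using t(1) by (intro image_eqI[of _ _ "1 - t"]) auto
    qed
  qed
qed

text \<open>At \<open>x = 1\<close> the base is 4 cos^2 (pi t). Each half of the period contributes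
  the same Beta value, and Legendre duplication at \<open>r + 1 / 2\<close> turns it into a central
  binomial coefficient.\<close>

lemma cos_integral_1:
  assumes r: "r > 0"
  shows "cos_integral r 1 = real_binomial (2 * r) r"
proof -
  let ?f = "\<lambda>t. (4 * (cos (pi * t))\<^sup>2) powr r" and ?I = "4 powr r * Beta (r + 1 / 2) (1 / 2) / (2 * pi)"
  have f: "?f = (\<lambda>t. (1 + 1\<^sup>2 + 2 * 1 * cos (2 * pi * t)) powr r)"
  proof
    fix t :: real
    have "cos (2 * pi * t) = 2 * (cos (pi * t))\<^sup>2 - 1" using cos_double_cos[of "pi * t"] by (simp add: mult.assoc)
    then show "?f t = (1 + 1\<^sup>2 + 2 * 1 * cos (2 * pi * t)) powr r" by simp
  qed
  have "(?f has_integral ?I) {0..1/2}" "(?f has_integral ?I) {1/2..1}"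
    using has_integral_cos_power[OF r _ cos_squared_bij(1,2)]
      has_integral_cos_power[OF r _ cos_squared_bij(3,4)]
    by (simp_all add: has_integral_Icc_iff_Ioo)
  then have "(?f has_integral (?I + ?I)) {0..1}"
    by (intro has_integral_combine[of 0 "1/2" 1]) auto
  then have "cos_integral r 1 = 4 powr r * Beta (r + 1 / 2) (1 / 2) / pi"
    unfolding cos_integral_def f[symmetric] by (simp add: integral_unique)
  also have "\<dots> = 4 powr r * (Gamma (r + 1 / 2) * sqrt pi / Gamma (r + 1)) / pi"
    by (simp add: Beta_def Gamma_one_half_real add.commute)
  also have "Gamma (r + 1 / 2) = 2 powr (- (2 * r)) * sqrt pi * Gamma (2 * r + 1) / Gamma (r + 1)"
  proof -
    have "Gamma (r + 1) > 0" using r by (intro Gamma_real_pos) auto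
    then have G: "Gamma (r + 1) \<noteq> 0" by simp
    have e: "r + 1 / 2 + 1 / 2 = r + 1" "1 - (2 * r + 1) = - (2 * r)" "2 * (r + 1 / 2) = 2 * r + 1"
      by simp_all
    have "r + 1 / 2 > 0" using r by simp
    from Gamma_legendre_duplication_real[OF this]
    show ?thesis unfolding nonzero_eq_divide_eq[OF G] e .
  qed
  also have "4 powr r * (2 powr (- (2 * r)) * sqrt pi * Gamma (2 * r + 1) / Gamma (r + 1) * sqrt pi / Gamma (r + 1)) / pi
      = Gamma (2 * r + 1) / (Gamma (r + 1) * Gamma (r + 1))"
  proof -
    have "(4::real) powr r = 2 powr (2 * r)" using powr_powr[of 2 2 r] by simp
    then have "4 powr r * (2::real) powr (- (2 * r)) = 1" by (simp add: powr_minus)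
    moreover have "A * (B * s * G / H * s / H) / pi = (A * B) * (s * s) / pi * (G / (H * H))" for A B s G H :: real
      by (simp add: mult_ac)
    ultimately show ?thesis by simp
  qed
  finally show ?thesis by (simp add: real_binomial_def)
qed

text \<open>The lower bound averages Bernoulli's inequality, whose cosine term has mean 0; the upper
  bound is the supremum 4^r of the integrand. Both are strict because they are strict at
  \<open>t = 1/2\<close>, where the base vanishes.\<close>

lemma cos_integral_1_bounds:
  assumes r: "r > 1"
  shows "2 powr r < cos_integral r 1" and "cos_integral r 1 < 2 powr (2 * r)"
proof -
  let ?f = "\<lambda>t. (1 + 1\<^sup>2 + 2 * 1 * cos (2 * pi * t)) powr r"
  have r0: "r > 0" using r by simp
  have int: "(?f has_integral cos_integral r 1) {0..1}"
    unfolding cos_integral_def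
    by (intro integrable_integral integrable_continuous_interval continuous_on_cos_integrand r0)
  let ?l = "\<lambda>t. 2 powr r * (1 + r * cos (2 * pi * t))"
  have l: "(?l has_integral 2 powr r) {0..1}"
    using has_integral_mult_right[OF has_integral_add[OF has_integral_const_real[of 1 0 1]
        has_integral_mult_right[OF has_integral_cos, of r]], of "2 powr r"] by simp
  have fc: "?f t = 2 powr r * (1 + cos (2 * pi * t)) powr r" for t
    using powr_mult[of 2 "1 + cos (2 * pi * t)" r] cos_ge_minus_one[of "2 * pi * t"] by (simp add: algebra_simps)
  \<comment> \<open>Bernoulli's inequality for a real exponent is Young's inequality for the pair
    \<open>1 + x\<close> and 1, with exponents \<open>r\<close> and
    \<open>r / (r - 1)\<close>.\<close>
  have bern: "1 + r * x \<le> (1 + x) powr r" if "x \<ge> -1" for x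
  proof -
    have "1 / (r / (r - 1)) = (r - 1) / r" using r by simp
    then have "1 / r + 1 / (r / (r - 1)) = 1" using r by (simp add: diff_divide_distrib)
    then have "(1 + x) * 1 \<le> (1 + x) powr r / r + 1 powr (r / (r - 1)) / (r / (r - 1))"
      using r that by (intro Youngs_inequality) (auto simp: field_simps)
    then have "r * (1 + x) \<le> r * ((1 + x) powr r / r + (r - 1) / r)"
      using r by (intro mult_left_mono) auto
    moreover have "r * ((1 + x) powr r / r + (r - 1) / r) = (1 + x) powr r + (r - 1)"
      using r by (simp add: distrib_left)
    ultimately show ?thesis by (simp add: algebra_simps)
  qed
  have "integral {0..1} (\<lambda>t. ?f t - ?l t) > 0"
  proof (rule integral_pos_if_pos_at_point[where s = "1/2"])
    show "continuous_on {0..1} (\<lambda>t. ?f t - ?l t)"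
      by (intro continuous_intros continuous_on_cos_integrand r0)
    show "?f t - ?l t \<ge> 0" for t
      unfolding fc using bern[of "cos (2 * pi * t)"] by (simp flip: right_diff_distrib)
    show "?f (1/2) - ?l (1/2) > 0" using r by (simp add: algebra_simps)
  qed simp
  moreover have "integral {0..1} (\<lambda>t. ?f t - ?l t) = cos_integral r 1 - 2 powr r"
    by (intro integral_unique has_integral_diff int l)
  ultimately show "2 powr r < cos_integral r 1" by simp
  have "integral {0..1} (\<lambda>t. 2 powr (2 * r) - ?f t) > 0"
  proof (rule integral_pos_if_pos_at_point[where s = "1/2"])
    show "continuous_on {0..1} (\<lambda>t. 2 powr (2 * r) - ?f t)"
      by (intro continuous_intros continuous_on_cos_integrand r0)
    show "2 powr (2 * r) - ?f t \<ge> 0" for t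
    proof -
      have "?f t \<le> 4 powr r"
        using cos_base_nonneg[of 1 "2 * pi * t"] r cos_le_one[of "2 * pi * t"] by (intro powr_mono2) auto
      also have "(4::real) powr r = 2 powr (2 * r)" using powr_powr[of 2 2 r] by simp
      finally show ?thesis by simp
    qed
    show "2 powr (2 * r) - ?f (1/2) > 0" using r by simp
  qed simp
  moreover have "integral {0..1} (\<lambda>t. 2 powr (2 * r) - ?f t) = 2 powr (2 * r) - cos_integral r 1"
    using has_integral_diff[OF has_integral_const_real[of "2 powr (2 * r)" 0 1] int] by (intro integral_unique) simp
  ultimately show "cos_integral r 1 < 2 powr (2 * r)" by simp
qed

text \<open>This is the inclusion of sequence spaces, raised to the power \<open>s\<close>: each
  f(x)^p is at most the total \<open>T\<close>, so f(x)^s is at most f(x)^p T^(s/p - 1), and the sum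
  over \<open>x\<close> follows.\<close>

lemma sum_powr_le_powr_sum:
  fixes f :: "'a \<Rightarrow> real"
  assumes "finite A" "\<And>x. x \<in> A \<Longrightarrow> f x \<ge> 0" "0 < p" "p \<le> s"
  shows "(\<Sum>x\<in>A. f x powr s) \<le> (\<Sum>x\<in>A. f x powr p) powr (s / p)"
proof -
  define T where "T = (\<Sum>x\<in>A. f x powr p)"
  have T: "T \<ge> 0" unfolding T_def by (intro sum_nonneg) auto
  have "f x powr s \<le> f x powr p * T powr (s / p - 1)" if "x \<in> A" for x
  proof -
    have "f x powr p \<le> T" unfolding T_def using that assms(1) by (intro member_le_sum) auto
    then have "(f x powr p) powr (s / p - 1) \<le> T powr (s / p - 1)"
      using assms by (intro powr_mono2) (auto simp: field_simps)
    then have "f x powr p * (f x powr p) powr (s / p - 1) \<le> f x powr p * T powr (s / p - 1)"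
      by (intro mult_left_mono) auto
    moreover have "f x powr p * (f x powr p) powr (s / p - 1) = f x powr s"
      using assms(3) by (simp add: powr_powr powr_add[symmetric] right_diff_distrib)
    ultimately show ?thesis by simp
  qed
  then have "(\<Sum>x\<in>A. f x powr s) \<le> (\<Sum>x\<in>A. f x powr p * T powr (s / p - 1))" by (intro sum_mono)
  also have "\<dots> = T * T powr (s / p - 1)" by (simp add: T_def sum_distrib_right)
  also have "\<dots> = T powr (s / p)" using T by (simp add: powr_mult_base)
  finally show ?thesis by (simp add: T_def)
qed

lemma cos_integral_one: "cos_integral 1 x = 1 + x\<^sup>2"
proof -
  have "((\<lambda>t. (1 + x\<^sup>2) + 2 * x * cos (2 * pi * t)) has_integral (1 + x\<^sup>2)) {0..1}"
    using has_integral_add[OF has_integral_const_real[of "1 + x\<^sup>2" 0 1] has_integral_mult_right[OF has_integral_cos, of "2 * x"]]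
    by simp
  then show ?thesis unfolding cos_integral_def using cos_base_nonneg[of x] by (simp add: integral_unique)
qed

text \<open>The critical exponent is \<open>q / log 2 I\<close>: it equals 2 for
  \<open>q = 2\<close> and lies strictly between 1 and 2 for \<open>q > 2\<close>, which is the
  range required in \<open>cos_integral_le\<close>.\<close>

lemma log2_central_binomial:
  fixes q :: real
  assumes q: "q \<ge> 2"
  defines "I \<equiv> real_binomial q (q / 2)"
  shows "q = 2 \<and> I = 2 \<or> q > 2 \<and> q / 2 < log 2 I \<and> log 2 I < q"
proof -
  have I: "I = cos_integral (q / 2) 1" using cos_integral_1[of "q / 2"] q by (simp add: I_def)
  have Ipos: "I > 0" using cos_integral_pos[of "q / 2" 1] q by (simp add: I)
  show ?thesis
  proof (cases "q = 2")
    case False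
    then have "q / 2 > 1" using q by simp
    from cos_integral_1_bounds[OF this] have "2 powr (q / 2) < I" "I < 2 powr q"
      by (simp_all add: I)
    then have "q / 2 < log 2 I" "log 2 I < q"
      using Ipos less_log_iff[of 2 I "q / 2"] log_less_iff[of 2 I q] by simp_all
    then show ?thesis using False q by simp
  qed (simp add: I cos_integral_one)
qed

lemma cos_integral_le_two_point:
  assumes q: "q \<ge> 2" and p: "p > 0"
    and h: "1 / p \<ge> 1 / q * log 2 (real_binomial q (q / 2))" and x: "0 \<le> x" "x \<le> 1"
  shows "cos_integral (q / 2) x \<le> (1 + x powr p) powr (q / p)"
proof -
  define I where "I = cos_integral (q / 2) 1"
  have I: "I = real_binomial q (q / 2)" using cos_integral_1[of "q / 2"] q by (simp add: I_def)
  have Ipos: "I > 0" using cos_integral_pos[of "q / 2" 1] q by (simp add: I_def)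
  note b = log2_central_binomial[OF q, folded I]
  then have Igt1: "log 2 I > 0" using q by auto
  \<comment> \<open>The critical exponent, chosen so that 2^(q/s) = I. The inequality is proved for
    \<open>s\<close> and then passed to the smaller exponent \<open>p\<close> by monotonicity of the
    sequence norms.\<close>
  define s where "s = q / log 2 I"
  have s: "s > 0" "p \<le> s" using h q p Igt1 unfolding I[symmetric] s_def by (auto simp: field_simps)
  have "cos_integral (q / 2) x \<le> (1 + x powr s) powr (q / s)"
  \<comment> \<open>For \<open>q = 2\<close> one has \<open>s = 2\<close> and both sides equal
    \<open>1 + x\<^sup>2\<close>; the value \<open>a = 1\<close> is outside the range of
    \<open>cos_integral_le\<close>.\<close>
  proof (cases "q = 2")
    case True
    then show ?thesis using b x by (simp add: s_def cos_integral_one)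
  next
    case False
    then have q2: "q / 2 > 1" using q by simp
    have b: "q / 2 < log 2 I" "log 2 I < q" using b False by auto
    have "cos_integral (q / 2) x \<le> (1 + x powr (2 * (s / 2))) powr (q / 2 / (s / 2))"
    proof (rule cos_integral_le)
      show "1 / 2 < s / 2" "s / 2 < 1" using b q Igt1 by (auto simp: s_def field_simps)
      show "cos_integral (q / 2) 1 = 2 powr (q / 2 / (s / 2))"
        using Ipos q Igt1 unfolding I_def[symmetric] by (simp add: s_def powr_log_cancel)
    qed (use q2 x in auto)
    then show ?thesis by simp
  qed
  also have "\<dots> \<le> ((1 + x powr p) powr (s / p)) powr (q / s)"
  proof (rule powr_mono2)
    show "1 + x powr s \<le> (1 + x powr p) powr (s / p)"
      using sum_powr_le_powr_sum[of "{0::nat, 1}" "\<lambda>i. if i = 0 then 1 else x" p s] x p s by simp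
  qed (use q s in \<open>auto simp: add_nonneg_nonneg\<close>)
  also have "\<dots> = (1 + x powr p) powr (q / p)" using s by (simp add: powr_powr)
  finally show ?thesis .
qed

section \<open>From complex coefficients to the ratio of their moduli\<close>

lemma circle_integral_eq:
  fixes f :: "real \<Rightarrow> 'a :: euclidean_space"
  assumes "continuous_on UNIV f"
  shows "(LINT t|circle. f t) = integral {0..1} f"
proof -
  have "set_integrable lborel {0..<1} f"
    by (rule set_integrable_subset[OF borel_integrable_atLeastAtMost'[of 0 1]])
      (auto intro: continuous_on_subset[OF assms])
  then have "(LINT x:{0..<1} | lborel. f x) = integral {0..<1} f"
    by (rule set_borel_integral_eq_integral)
  moreover have "(LINT t|circle. f t) = (LINT x:{0..<1} | lborel. f x)"
    unfolding circle_def set_lebesgue_integral_def by (rule integral_restrict_space) simp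
  moreover have "{0..1} - {0..<1} = {1::real}" by auto
  then have "integral {0..<1} f = integral {0..1} f"
    by (intro integral_subset_negligible) auto
  ultimately show ?thesis by simp
qed

lemma integral_periodic_shift:
  fixes F :: "real \<Rightarrow> real"
  assumes cont: "continuous_on UNIV F" and per: "\<And>t. F (t + 1) = F t" and c: "0 \<le> c" "c \<le> 1"
  shows "integral {0..1} (\<lambda>t. F (t + c)) = integral {0..1} F"
proof -
  have int: "F integrable_on {a..b}" for a b
    using cont continuous_on_subset by (intro integrable_continuous_interval) blast
  have "integral {0..1} (F \<circ> (+) c) = integral {c..1 + c} F"
    by (simp add: integral_shift_Icc_real)
  also have "\<dots> = integral {c..1} F + integral {1..1 + c} F"
    using c int by (intro Henstock_Kurzweil_Integration.integral_combine[symmetric]) auto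
  also have "integral {1..1 + c} F = integral {0..c} (F \<circ> (+) 1)"
    by (simp add: integral_shift_Icc_real add.commute)
  also have "F \<circ> (+) 1 = F" using per by (auto simp: add.commute)
  also have "integral {c..1} F + integral {0..c} F = integral {0..1} F"
    using c int Henstock_Kurzweil_Integration.integral_combine[of 0 c 1 F] by simp
  finally show ?thesis by (simp add: comp_def add.commute)
qed

lemma norm_add_cis_squared:
  obtains c where "0 \<le> c" "c \<le> 1" and
    "\<And>t. (norm (a + b * cis (- (2 * pi * t))))\<^sup>2 =
      (norm a)\<^sup>2 + (norm b)\<^sup>2 + 2 * norm a * norm b * cos (2 * pi * (t + c))"
proof -
  define z where "z = cnj a * b"
  \<comment> \<open>The phase of \<open>cnj a * b\<close> becomes a translation in \<open>t\<close>;
    adding a full period puts \<open>c\<close> in the interval from 0 to 1, as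
    \<open>integral_periodic_shift\<close> demands.\<close>
  define c where "c = 1 - Arg2pi z / (2 * pi)"
  have A: "0 \<le> Arg2pi z" "Arg2pi z < 2 * pi" using Arg2pi[of z] by auto
  have "Arg2pi z / (2 * pi) \<ge> 0" "Arg2pi z / (2 * pi) < 1" using A by (simp_all add: divide_less_eq_1_pos)
  then have c: "0 \<le> c" "c \<le> 1" unfolding c_def by linarith+
  have z: "z = of_real (norm z) * cis (Arg2pi z)" using Arg2pi_eq[of z] by (simp add: cis_conv_exp)
  have "(norm (a + b * cis (- (2 * pi * t))))\<^sup>2 =
      (norm a)\<^sup>2 + (norm b)\<^sup>2 + 2 * norm a * norm b * cos (2 * pi * (t + c))" for t
  proof -
    let ?w = "cis (- (2 * pi * t))"
    have "(norm (a + b * ?w))\<^sup>2 = (norm a)\<^sup>2 + (norm (b * ?w))\<^sup>2 + 2 * Re (cnj a * (b * ?w))"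
      by (simp only: cmod_power2) (simp add: power2_eq_square algebra_simps)
    also have "norm (b * ?w) = norm b" by (simp add: norm_mult)
    also have "cnj a * (b * ?w) = of_real (norm z) * (cis (Arg2pi z) * ?w)"
      using z by (simp add: z_def mult.assoc)
    also have "cis (Arg2pi z) * ?w = cis (Arg2pi z - 2 * pi * t)" by (simp add: cis_mult)
    also have "Re (of_real (norm z) * cis (Arg2pi z - 2 * pi * t)) = norm a * norm b * cos (Arg2pi z - 2 * pi * t)"
      by (simp add: z_def norm_mult)
    also have "cos (Arg2pi z - 2 * pi * t) = cos (2 * pi * (t + c))"
    proof -
      have "2 * pi * (t + c) = - (Arg2pi z - 2 * pi * t) + 2 * pi" by (simp add: c_def field_simps)
      then show ?thesis by (metis cos_minus cos_periodic)
    qed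
    finally show ?thesis by simp
  qed
  with c that show ?thesis by blast
qed

text \<open>The relative phase of \<open>a\<close> and \<open>b\<close> disappears under a
  translation of the circle. The resulting formula is symmetric in \<open>a\<close> and
  \<open>b\<close>.\<close>

lemma two_point_integral_eq:
  assumes "q > 0"
  shows "(LINT t|circle. norm (a + b * cis (- (2 * pi * t))) powr q) =
    integral {0..1} (\<lambda>t. ((norm a)\<^sup>2 + (norm b)\<^sup>2 + 2 * norm a * norm b * cos (2 * pi * t)) powr (q / 2))"
proof -
  let ?F = "\<lambda>t. ((norm a)\<^sup>2 + (norm b)\<^sup>2 + 2 * norm a * norm b * cos (2 * pi * t)) powr (q / 2)"
  obtain c where c: "0 \<le> c" "c \<le> 1" and
    N: "\<And>t. (norm (a + b * cis (- (2 * pi * t))))\<^sup>2 =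
      (norm a)\<^sup>2 + (norm b)\<^sup>2 + 2 * norm a * norm b * cos (2 * pi * (t + c))"
    using norm_add_cis_squared by blast
  have pw: "norm (a + b * cis (- (2 * pi * t))) powr q = ?F (t + c)" for t
    unfolding N[symmetric]
    by (simp add: powr_powr flip: powr_numeral)
  have nn: "(norm a)\<^sup>2 + (norm b)\<^sup>2 + 2 * norm a * norm b * cos (2 * pi * t) \<ge> 0" for t
    using N[of "t - c"] by (metis diff_add_cancel zero_le_power2)
  have cont: "continuous_on UNIV ?F"
    by (intro continuous_on_powr' continuous_intros) (use assms nn in auto)
  have "continuous_on UNIV (\<lambda>t. ?F (t + c))"
    by (rule continuous_on_compose2[OF cont]) (intro continuous_intros, simp)
  then have "(LINT t|circle. norm (a + b * cis (- (2 * pi * t))) powr q) = integral {0..1} (\<lambda>t. ?F (t + c))"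
    unfolding pw by (rule circle_integral_eq)
  also have "\<dots> = integral {0..1} ?F"
  proof (rule integral_periodic_shift[OF cont _ c])
    show "?F (t + 1) = ?F t" for t by (simp add: distrib_left cos_periodic)
  qed
  finally show ?thesis .
qed

lemma two_point_integral_eq_cos_integral:
  assumes "q > 0" "norm b \<le> norm a" "a \<noteq> 0"
  shows "(LINT t|circle. norm (a + b * cis (- (2 * pi * t))) powr q) =
    norm a powr q * cos_integral (q / 2) (norm b / norm a)"
proof -
  let ?x = "norm b / norm a"
  have "((norm a)\<^sup>2 + (norm b)\<^sup>2 + 2 * norm a * norm b * c) powr (q / 2) =
      norm a powr q * (1 + ?x\<^sup>2 + 2 * ?x * c) powr (q / 2)" for c
  proof -
    have "(norm a)\<^sup>2 + (norm b)\<^sup>2 + 2 * norm a * norm b * c = (norm a)\<^sup>2 * (1 + ?x\<^sup>2 + 2 * ?x * c)"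
      using assms(3) by (simp add: field_simps power2_eq_square)
    also have "\<dots> powr (q / 2) = ((norm a)\<^sup>2) powr (q / 2) * (1 + ?x\<^sup>2 + 2 * ?x * c) powr (q / 2)"
      by (rule powr_mult)
    also have "((norm a)\<^sup>2) powr (q / 2) = norm a powr q"
      by (simp add: powr_powr flip: powr_numeral)
    finally show ?thesis .
  qed
  then show ?thesis
    unfolding two_point_integral_eq[OF assms(1)] cos_integral_def by simp
qed

lemma two_point_inequality:
  assumes q: "q \<ge> 2" and p: "p > 0"
    and h: "1 / p \<ge> 1 / q * log 2 (real_binomial q (q / 2))"
  shows "(LINT t|circle. norm (a + b * cis (- (2 * pi * t))) powr q) \<le> (norm a powr p + norm b powr p) powr (q / p)"
proof -
  have main: "(LINT t|circle. norm (a + b * cis (- (2 * pi * t))) powr q) \<le> (norm a powr p + norm b powr p) powr (q / p)"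
    if ab: "norm b \<le> norm a" for a b :: complex
  proof (cases "a = 0")
    case True
    then show ?thesis using ab by simp
  next
    case False
    let ?x = "norm b / norm a"
    have x: "0 \<le> ?x" "?x \<le> 1" using ab False by auto
    have "(LINT t|circle. norm (a + b * cis (- (2 * pi * t))) powr q) = norm a powr q * cos_integral (q / 2) ?x"
      using two_point_integral_eq_cos_integral ab False q by simp
    also have "\<dots> \<le> norm a powr q * (1 + ?x powr p) powr (q / p)"
      by (intro mult_left_mono cos_integral_le_two_point q p h x) auto
    also have "norm a powr q = (norm a powr p) powr (q / p)" using p by (simp add: powr_powr)
    also have "(norm a powr p) powr (q / p) * (1 + ?x powr p) powr (q / p) = (norm a powr p * (1 + ?x powr p)) powr (q / p)"
      by (rule powr_mult[symmetric])
    also have "norm a powr p * (1 + ?x powr p) = norm a powr p + norm b powr p"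
      using False by (simp add: powr_divide field_simps)
    finally show ?thesis .
  qed
  show ?thesis
  proof (cases "norm b \<le> norm a")
    case False
    \<comment> \<open>By this symmetry the larger modulus may be taken first, which brings the ratio
      down to at most 1.\<close>
    have "(LINT t|circle. norm (a + b * cis (- (2 * pi * t))) powr q) = (LINT t|circle. norm (b + a * cis (- (2 * pi * t))) powr q)"
      using q by (subst (1 2) two_point_integral_eq) (simp_all add: add.commute mult_ac)
    then show ?thesis using main[of a b] False by (simp add: add.commute)
  qed (rule main)
qed

section \<open>Tensorisation\<close>

lemma finite_cube [simp]: "finite (cube d)"
  unfolding cube_def by (intro finite_PiE) auto

lemma cube_subset_lattice: "cube d \<subseteq> lattice d"
  unfolding cube_def lattice_def by (intro PiE_mono) auto

lemma sum_cube_Suc: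
  fixes g :: "(nat \<Rightarrow> int) \<Rightarrow> 'a :: comm_monoid_add"
  shows "(\<Sum>x\<in>cube (Suc d). g x) = (\<Sum>x\<in>cube d. g (x(d := 0)) + g (x(d := 1)))"
proof -
  have inj: "inj_on (\<lambda>(y, x). x(d := y)) ({0, 1} \<times> cube d)"
  proof (rule inj_onI, clarify)
    fix y z :: int and x w assume xw: "x \<in> cube d" "w \<in> cube d" and e: "x(d := y) = w(d := z)"
    \<comment> \<open>Points of \<open>cube d\<close> carry the default value at the index
      \<open>d\<close>, so overwriting that coordinate loses no information.\<close>
    have "x d = undefined" "w d = undefined" using xw by (auto simp: cube_def PiE_def extensional_def)
    then show "y = z \<and> x = w" using e by (metis fun_upd_same fun_upd_triv fun_upd_upd)
  qed
  have "cube (Suc d) = (\<lambda>(y, x). x(d := y)) ` ({0, 1} \<times> cube d)"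
    unfolding cube_def lessThan_Suc PiE_insert_eq by simp
  then have "(\<Sum>x\<in>cube (Suc d). g x) = (\<Sum>(y, x)\<in>{0, 1} \<times> cube d. g (x(d := y)))"
    using inj by (simp add: sum.reindex case_prod_beta' comp_def)
  also have "\<dots> = (\<Sum>y\<in>{0, 1}. \<Sum>x\<in>cube d. g (x(d := y)))"
    by (rule sum.cartesian_product[symmetric])
  also have "\<dots> = (\<Sum>x\<in>cube d. g (x(d := 0)) + g (x(d := 1)))"
    by (simp add: sum.distrib)
  finally show ?thesis .
qed

lemma cube_0: "cube 0 = {\<lambda>_. undefined}"
  by (simp add: cube_def)

lemma norm_character [simp]: "norm (character d x \<xi>) = 1"
  by (simp add: character_def norm_exp_eq_Re)

lemma character_Suc:
  "character (Suc d) (x(d := k)) (\<xi>(d := t)) = character d x \<xi> * cis (- (2 * pi * (k * t)))"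
proof -
  have "(\<Sum>i<d. real_of_int ((x(d := k)) i) * (\<xi>(d := t)) i) = (\<Sum>i<d. real_of_int (x i) * \<xi> i)"
    by (intro sum.cong) auto
  then show ?thesis
    by (simp add: character_def cis_conv_exp algebra_simps flip: exp_add)
qed

lemma component_measurable_torus:
  assumes "i < d"
  shows "(\<lambda>\<xi>. \<xi> i) \<in> borel_measurable (torus d)"
proof -
  have "(\<lambda>\<xi>. \<xi> i) \<in> measurable (torus d) circle"
    unfolding torus_def using assms by (intro measurable_component_singleton) auto
  then have "(\<lambda>\<xi>. \<xi> i) \<in> measurable (torus d) lborel"
    unfolding circle_def by (rule measurable_restrict_space2_iff[THEN iffD1, THEN conjunct1])
  then show ?thesis by simp
qed

lemma character_measurable [measurable]: "character d x \<in> borel_measurable (torus d)"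
proof -
  have "(\<lambda>\<xi>. \<Sum>i<d. real_of_int (x i) * \<xi> i) \<in> borel_measurable (torus d)"
    by (intro borel_measurable_sum borel_measurable_times component_measurable_torus) auto
  then show ?thesis
    unfolding character_def[abs_def] by measurable
qed

definition cube_poly :: "nat \<Rightarrow> ((nat \<Rightarrow> int) \<Rightarrow> complex) \<Rightarrow> (nat \<Rightarrow> real) \<Rightarrow> complex" where
  "cube_poly d f \<xi> = (\<Sum>x\<in>cube d. f x * character d x \<xi>)"

lemma fourier_lattice_eq_cube_poly:
  assumes "\<And>x. x \<in> lattice d \<Longrightarrow> x \<notin> cube d \<Longrightarrow> f x = 0"
  shows "fourier_lattice d f = cube_poly d f"
proof
  fix \<xi>
  have "(\<Sum>\<^sub>\<infinity>x\<in>lattice d. f x * character d x \<xi>) = (\<Sum>\<^sub>\<infinity>x\<in>cube d. f x * character d x \<xi>)"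
    using assms cube_subset_lattice by (intro infsum_cong_neutral) auto
  then show "fourier_lattice d f \<xi> = cube_poly d f \<xi>"
    by (simp add: fourier_lattice_def cube_poly_def)
qed

lemma cube_poly_measurable [measurable]: "cube_poly d f \<in> borel_measurable (torus d)"
  unfolding cube_poly_def[abs_def] by measurable

lemma norm_cube_poly_le: "norm (cube_poly d f \<xi>) \<le> (\<Sum>x\<in>cube d. norm (f x))"
  unfolding cube_poly_def by (rule sum_norm_le) (simp add: norm_mult)

text \<open>With the first \<open>d\<close> coordinates frozen, the polynomial takes the form a + b
  e^(-2 pi i t) treated by the two-point inequality.\<close>

lemma cube_poly_Suc:
  "cube_poly (Suc d) f (\<xi>(d := t)) =
    cube_poly d (\<lambda>x. f (x(d := 0))) \<xi> + cube_poly d (\<lambda>x. f (x(d := 1))) \<xi> * cis (- (2 * pi * t))"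
proof -
  have "cis (- (2 * pi * (real_of_int 0 * t))) = 1" "cis (- (2 * pi * (real_of_int 1 * t))) = cis (- (2 * pi * t))"
    by simp_all
  then show ?thesis
    unfolding cube_poly_def sum_cube_Suc character_Suc sum.distrib sum_distrib_right by (simp add: mult.assoc)
qed

lemma torus_integrable_bounded:
  fixes g :: "_ \<Rightarrow> 'a :: {banach, second_countable_topology}"
  assumes "g \<in> borel_measurable (torus d)" "\<And>\<xi>. norm (g \<xi>) \<le> B"
  shows "integrable (torus d) g"
proof -
  interpret prob_space "torus d" by (rule prob_space_torus)
  show ?thesis using assms by (intro integrable_const_bound[of _ B]) auto
qed

lemma cube_poly_integrable:
  assumes "q \<ge> 0"
  shows "integrable (torus d) (\<lambda>\<xi>. norm (cube_poly d f \<xi>) powr q)"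
proof (rule torus_integrable_bounded)
  show "norm (norm (cube_poly d f \<xi>) powr q) \<le> (\<Sum>x\<in>cube d. norm (f x)) powr q" for \<xi>
    using norm_cube_poly_le[of d f \<xi>] assms by (simp add: powr_mono2)
qed measurable

lemma torus_integral_Suc:
  fixes g :: "_ \<Rightarrow> 'a :: {banach, second_countable_topology}"
  assumes "integrable (torus (Suc d)) g"
  shows "(LINT \<xi>|torus (Suc d). g \<xi>) = (LINT \<xi>|torus d. LINT t|circle. g (\<xi>(d := t)))"
proof -
  interpret product_sigma_finite "\<lambda>_::nat. circle"
    by unfold_locales (use prob_space_circle prob_space_imp_sigma_finite sigma_finite_measure.sigma_finite_countable in auto)
  show ?thesis
    using product_integral_insert[of "{..<d}" d g] assms unfolding torus_def lessThan_Suc by simp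
qed

text \<open>Convexity of x^s at the points \<open>u / A\<close> and \<open>v / B\<close> with
  weights A/(A+B) and B/(A+B). Being linear in the powers of \<open>u\<close> and \<open>v\<close>,
  the bound can be integrated; Minkowski's inequality follows when \<open>A\<close> and
  \<open>B\<close> are close to the two norms.\<close>

lemma powr_add_le:
  fixes u v A B s :: real
  assumes s: "s \<ge> 1" and uv: "u \<ge> 0" "v \<ge> 0" and AB: "A > 0" "B > 0"
  shows "(u + v) powr s \<le> (A + B) powr (s - 1) * (u powr s * A powr (1 - s) + v powr s * B powr (1 - s))"
proof (cases "u > 0 \<and> v > 0")
  case True
  have "convex_on {0<..} (\<lambda>x. x powr s)" by (rule powr_convex[OF s])
  from convex_onD[OF this, of "B / (A + B)" "u / A" "v / B"]
  have "((1 - B / (A + B)) * (u / A) + B / (A + B) * (v / B)) powr s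
      \<le> (1 - B / (A + B)) * (u / A) powr s + B / (A + B) * (v / B) powr s"
    using True AB by simp
  also have "1 - B / (A + B) = A / (A + B)" using AB by (simp add: field_simps)
  also have "A / (A + B) * (u / A) + B / (A + B) * (v / B) = (u + v) / (A + B)"
    using AB by (simp add: add_divide_distrib)
  also have "\<dots> powr s = (u + v) powr s / (A + B) powr s" by (simp add: powr_divide)
  finally have "(u + v) powr s / (A + B) powr s \<le> (A / (A + B) * (u / A) powr s + B / (A + B) * (v / B) powr s)" .
  then have "(u + v) powr s \<le> (A / (A + B) * (u / A) powr s + B / (A + B) * (v / B) powr s) * (A + B) powr s"
    using AB by (simp add: divide_le_eq)
  also have "\<dots> = (A + B) powr (s - 1) * (u powr s * A powr (1 - s) + v powr s * B powr (1 - s))"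
  proof -
    have "X / S * (w / X) powr s * S powr s = S powr (s - 1) * (w powr s * X powr (1 - s))"
      if "X > 0" "S > 0" for X S w :: real
      using that by (simp add: powr_divide powr_diff)
    from this[OF AB(1), of "A + B" u] this[OF AB(2), of "A + B" v] AB
    show ?thesis by (simp only: distrib_left distrib_right)
  qed
  finally show ?thesis .
next
  case False
  \<comment> \<open>The convexity fact lives on the open half-line, so a vanishing \<open>u\<close>
    or \<open>v\<close> is handled by monotonicity.\<close>
  have mono: "u powr s \<le> (A + B) powr (s - 1) * (u powr s * A powr (1 - s))" if "A > 0" "B > 0" for A B u :: real
  proof -
    have "A powr (s - 1) \<le> (A + B) powr (s - 1)" using that s by (intro powr_mono2) auto
    moreover have "A powr (1 - s) = 1 / A powr (s - 1)" using powr_minus_divide[of A "s - 1"] by simp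
    ultimately have "1 \<le> (A + B) powr (s - 1) * A powr (1 - s)"
      using that by (simp add: le_divide_eq)
    then have "u powr s * 1 \<le> u powr s * ((A + B) powr (s - 1) * A powr (1 - s))"
      by (intro mult_left_mono) auto
    then show ?thesis by (simp add: mult_ac)
  qed
  from False uv consider "u = 0" | "v = 0" by linarith
  then show ?thesis using mono[OF AB, of u] mono[OF AB(2,1), of v] by cases (simp_all add: add.commute)
qed

lemma Minkowski_two:
  fixes u v :: "'a \<Rightarrow> real"
  assumes s: "s \<ge> 1" and uv: "\<And>x. u x \<ge> 0" "\<And>x. v x \<ge> 0"
    and int: "integrable M (\<lambda>x. u x powr s)" "integrable M (\<lambda>x. v x powr s)"
      "integrable M (\<lambda>x. (u x + v x) powr s)"
  shows "(LINT x|M. (u x + v x) powr s) \<le>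
    ((LINT x|M. u x powr s) powr (1 / s) + (LINT x|M. v x powr s) powr (1 / s)) powr s"
proof -
  define A0 where "A0 = (LINT x|M. u x powr s) powr (1 / s)"
  define B0 where "B0 = (LINT x|M. v x powr s) powr (1 / s)"
  let ?I = "LINT x|M. (u x + v x) powr s"
  have nn: "A0 \<ge> 0" "B0 \<ge> 0" by (simp_all add: A0_def B0_def)
  have pw: "(LINT x|M. u x powr s) = A0 powr s" "(LINT x|M. v x powr s) = B0 powr s"
    using s by (simp_all add: A0_def B0_def powr_powr)
  have "?I powr (1 / s) \<le> A0 + B0"
  proof (rule field_le_epsilon)
    fix e :: real assume e: "e > 0"
    \<comment> \<open>The margin \<open>e / 2\<close> keeps the weights positive even when a norm
      vanishes.\<close>
    define A where "A = A0 + e / 2"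
    define B where "B = B0 + e / 2"
    have AB: "A > 0" "B > 0" "A0 \<le> A" "B0 \<le> B" using nn e by (auto simp: A_def B_def)
    have le: "X0 powr s * X powr (1 - s) \<le> X" if "0 \<le> X0" "X0 \<le> X" "X > 0" for X0 X :: real
    proof -
      have "X0 powr s * X powr (1 - s) \<le> X powr s * X powr (1 - s)"
        using that s by (intro mult_right_mono powr_mono2) auto
      also have "\<dots> = X" using that by (simp add: powr_add[symmetric])
      finally show ?thesis .
    qed
    have "?I \<le> (LINT x|M. (A + B) powr (s - 1) * (u x powr s * A powr (1 - s) + v x powr s * B powr (1 - s)))"
      by (intro integral_mono int integrable_mult_right integrable_mult_left integrable_add Bochner_Integration.integrable_add
          powr_add_le s uv AB)
    also have "\<dots> = (A + B) powr (s - 1) * (A0 powr s * A powr (1 - s) + B0 powr s * B powr (1 - s))"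
      using int by (simp add: pw)
    also have "\<dots> \<le> (A + B) powr (s - 1) * (A + B)"
      using le AB nn by (intro mult_left_mono add_mono) auto
    also have "\<dots> = (A + B) powr s" using AB by (simp add: powr_diff)
    finally have "?I powr (1 / s) \<le> ((A + B) powr s) powr (1 / s)"
      using s uv by (intro powr_mono2 Bochner_Integration.integral_nonneg) auto
    then show "?I powr (1 / s) \<le> A0 + B0 + e"
      using AB s by (simp add: powr_powr A_def B_def)
  qed
  then have "(?I powr (1 / s)) powr s \<le> (A0 + B0) powr s" using s by (intro powr_mono2) auto
  moreover have "?I \<ge> 0" by (intro Bochner_Integration.integral_nonneg) auto
  ultimately show ?thesis using s by (simp add: powr_powr A0_def B0_def)
qed

text \<open>Induction on the dimension: the two-point inequality in the last coordinate, Minkowski's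
  inequality in L^(q/p) over the remaining ones, then the induction hypothesis on the two faces of
  the cube. The hypothesis \<open>p \<le> q\<close> makes \<open>q / p\<close> an admissible
  Minkowski exponent.\<close>

lemma tensorization:
  assumes p: "0 < p" "p \<le> q"
    and two: "\<And>a b. (LINT t|circle. norm (a + b * cis (- (2 * pi * t))) powr q) \<le> (norm a powr p + norm b powr p) powr (q / p)"
  shows "(LINT \<xi>|torus d. norm (cube_poly d f \<xi>) powr q) \<le> (\<Sum>x\<in>cube d. norm (f x) powr p) powr (q / p)"
proof (induction d arbitrary: f)
  case 0
  interpret prob_space "torus 0" by (rule prob_space_torus)
  have "norm (cube_poly 0 f \<xi>) = norm (f (\<lambda>_. undefined))" for \<xi>
    by (simp add: cube_poly_def cube_0 norm_mult)
  then show ?case using p by (simp add: cube_0 powr_powr prob_space)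
next
  case (Suc d)
  let ?F = "\<lambda>k. cube_poly d (\<lambda>x. f (x(d := k)))"
  let ?S = "\<lambda>k. \<Sum>x\<in>cube d. norm (f (x(d := k))) powr p"
  have q0: "q \<ge> 0" using p by simp
  have int: "integrable (torus d) (\<lambda>\<xi>. (norm (?F 0 \<xi>) powr p + norm (?F 1 \<xi>) powr p) powr (q / p))"
  proof (rule torus_integrable_bounded)
    fix \<xi>
    have "norm (?F 0 \<xi>) powr p + norm (?F 1 \<xi>) powr p \<le>
        (\<Sum>x\<in>cube d. norm (f (x(d := 0)))) powr p + (\<Sum>x\<in>cube d. norm (f (x(d := 1)))) powr p"
      using norm_cube_poly_le p by (intro add_mono powr_mono2) auto
    then show "norm ((norm (?F 0 \<xi>) powr p + norm (?F 1 \<xi>) powr p) powr (q / p)) \<le>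
        ((\<Sum>x\<in>cube d. norm (f (x(d := 0)))) powr p + (\<Sum>x\<in>cube d. norm (f (x(d := 1)))) powr p) powr (q / p)"
      using p by (simp add: powr_mono2)
  qed measurable
  have "(LINT \<xi>|torus (Suc d). norm (cube_poly (Suc d) f \<xi>) powr q) =
      (LINT \<xi>|torus d. LINT t|circle. norm (?F 0 \<xi> + ?F 1 \<xi> * cis (- (2 * pi * t))) powr q)"
    by (subst torus_integral_Suc[OF cube_poly_integrable[OF q0]]) (simp add: cube_poly_Suc)
  \<comment> \<open>The inner integral on the left is compared pointwise; the integrability that
    enters is that of the larger side, \<open>int\<close>.\<close>
  also have "\<dots> \<le> (LINT \<xi>|torus d. (norm (?F 0 \<xi>) powr p + norm (?F 1 \<xi>) powr p) powr (q / p))"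
  proof (rule integral_mono_AE'[OF int])
    show "AE \<xi> in torus d. 0 \<le> (norm (?F 0 \<xi>) powr p + norm (?F 1 \<xi>) powr p) powr (q / p)" by simp
  qed (use two in auto)
  also have "\<dots> \<le> ((LINT \<xi>|torus d. (norm (?F 0 \<xi>) powr p) powr (q / p)) powr (1 / (q / p)) +
      (LINT \<xi>|torus d. (norm (?F 1 \<xi>) powr p) powr (q / p)) powr (1 / (q / p))) powr (q / p)"
    using p q0 int by (intro Minkowski_two) (auto simp: powr_powr cube_poly_integrable)
  also have "\<dots> \<le> (?S 0 + ?S 1) powr (q / p)"
  proof -
    have "(LINT \<xi>|torus d. (norm (?F k \<xi>) powr p) powr (q / p)) powr (1 / (q / p)) \<le> ?S k" for k
    proof -
      have "(LINT \<xi>|torus d. (norm (?F k \<xi>) powr p) powr (q / p)) \<le> ?S k powr (q / p)"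
        using Suc.IH[of "\<lambda>x. f (x(d := k))"] p by (simp add: powr_powr)
      then have "(LINT \<xi>|torus d. (norm (?F k \<xi>) powr p) powr (q / p)) powr (1 / (q / p)) \<le> (?S k powr (q / p)) powr (1 / (q / p))"
        using p by (intro powr_mono2 Bochner_Integration.integral_nonneg) auto
      also have "\<dots> = ?S k" using p by (simp add: powr_powr sum_nonneg)
      finally show ?thesis .
    qed
    then show ?thesis using p by (intro powr_mono2 add_mono) (auto simp: add_nonneg_nonneg)
  qed
  also have "?S 0 + ?S 1 = (\<Sum>x\<in>cube (Suc d). norm (f x) powr p)"
    by (simp add: sum_cube_Suc sum.distrib)
  finally show ?case .
qed

section \<open>Hoelder duality\<close>

lemma conjugate_exponents_cases:
  fixes p p' :: ennreal
  assumes "1 \<le> p" "1 \<le> p'" "1 / p + 1 / p' = 1"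
  obtains "p = \<infinity>" "p' = 1" | "p = 1" "p' = \<infinity>"
  | P P' where "p = ennreal P" "p' = ennreal P'" "1 < P" "1 < P'" "1 / P + 1 / P' = 1"
proof (cases p rule: ennreal_cases)
  case top
  then have "1 / p' = 1" using assms by simp
  then have "p' = 1"
    by (cases p' rule: ennreal_cases) (use assms in \<open>auto simp: divide_ennreal simp flip: ennreal_1\<close>)
  then show ?thesis using that(1) top by simp
next
  case (real P)
  then have P: "P \<ge> 1" using assms(1) by (simp flip: ennreal_1)
  have p1: "1 / p = ennreal (1 / P)" using real P by (simp add: divide_ennreal flip: ennreal_1)
  show ?thesis
  proof (cases p' rule: ennreal_cases)
    case top
    then have "ennreal (1 / P) = ennreal 1" using assms(3) p1 by simp
    then have "1 / P = 1" using P by (subst (asm) ennreal_inj) auto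
    then show ?thesis using that(2) top real P by simp
  next
    case (real P')
    then have P': "P' \<ge> 1" using assms(2) by (simp flip: ennreal_1)
    have "1 / p' = ennreal (1 / P')" using real P' by (simp add: divide_ennreal flip: ennreal_1)
    then have "ennreal (1 / P + 1 / P') = ennreal 1" using assms(3) p1 P P' by simp
    then have e: "1 / P + 1 / P' = 1" using P P' by (subst (asm) ennreal_inj) auto
    moreover have "1 / P > 0" "1 / P' > 0" using P P' by auto
    ultimately have "1 / P < 1" "1 / P' < 1" by linarith+
    then have "1 < P" "1 < P'" using P P' by (auto simp: divide_less_eq)
    then show ?thesis using that(3)[OF \<open>p = ennreal P\<close> real(2)] e by blast
  qed
qed

lemma Lp_space_finite_iff:
  "p \<noteq> \<infinity> \<Longrightarrow> f \<in> Lp_space p M \<longleftrightarrow> f \<in> borel_measurable M \<and> integrable M (\<lambda>x. norm (f x) powr enn2real p)"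
  by (simp add: Lp_space_def)

lemma Lp_norm_finite:
  "p \<noteq> \<infinity> \<Longrightarrow> Lp_norm p M f = (LINT x|M. norm (f x) powr enn2real p) powr (1 / enn2real p)"
  by (simp add: Lp_norm_def)

lemma Lp_norm_nonneg [simp]: "Lp_norm p M f \<ge> 0"
  by (simp add: Lp_norm_def)

lemma Linf_AE:
  assumes "f \<in> Lp_space \<infinity> M"
  shows "AE x in M. norm (f x) \<le> Lp_norm \<infinity> M f"
proof -
  let ?e = "esssup M (\<lambda>x. ennreal (norm (f x)))"
  have fin: "?e < \<infinity>" using assms by (simp add: Lp_space_def)
  have "AE x in M. ennreal (norm (f x)) \<le> ?e" by (rule esssup_AE)
  moreover have "norm (f x) \<le> enn2real ?e" if "ennreal (norm (f x)) \<le> ?e" for x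
    using enn2real_mono[OF that] fin by simp
  ultimately show ?thesis by (auto simp: Lp_norm_def elim: eventually_mono)
qed

lemma Linf_bounded:
  assumes "f \<in> borel_measurable M" "AE x in M. norm (f x) \<le> c" "c \<ge> 0"
  shows "f \<in> Lp_space \<infinity> M" and "Lp_norm \<infinity> M f \<le> c"
proof -
  let ?e = "esssup M (\<lambda>x. ennreal (norm (f x)))"
  have le: "?e \<le> ennreal c"
    by (rule esssup_I) (use assms in \<open>auto elim!: eventually_mono intro: ennreal_leI\<close>)
  have "?e < \<infinity>" by (rule order_le_less_trans[OF le]) simp
  then show "f \<in> Lp_space \<infinity> M" using assms by (simp add: Lp_space_def)
  have "enn2real ?e \<le> enn2real (ennreal c)" using le by (intro enn2real_mono) auto
  then show "Lp_norm \<infinity> M f \<le> c" using assms by (simp add: Lp_norm_def)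
qed

text \<open>Young's inequality is applied to \<open>u\<close> and \<open>v\<close> divided by their
  norms enlarged by \<open>e\<close>. Letting \<open>e\<close> tend to 0 at the end covers vanishing
  norms without a separate case.\<close>

lemma Holder_real:
  fixes u v :: "'a \<Rightarrow> real"
  assumes P: "1 < P" "1 < P'" "1 / P + 1 / P' = 1"
    and meas: "u \<in> borel_measurable M" "v \<in> borel_measurable M"
    and nn: "\<And>x. u x \<ge> 0" "\<And>x. v x \<ge> 0"
    and int: "integrable M (\<lambda>x. u x powr P)" "integrable M (\<lambda>x. v x powr P')"
  shows "integrable M (\<lambda>x. u x * v x)"
    and "(LINT x|M. u x * v x) \<le> (LINT x|M. u x powr P) powr (1 / P) * (LINT x|M. v x powr P') powr (1 / P')"
proof -
  have Y: "u x * v x \<le> u x powr P / P + v x powr P' / P'" for x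
    using Youngs_inequality[OF P nn] by simp
  show I: "integrable M (\<lambda>x. u x * v x)"
  proof (rule Bochner_Integration.integrable_bound)
    show "integrable M (\<lambda>x. u x powr P / P + v x powr P' / P')"
      using int by simp
    show "AE x in M. norm (u x * v x) \<le> norm (u x powr P / P + v x powr P' / P')"
      using Y nn P by (auto simp: abs_of_nonneg)
  qed (use meas in measurable)
  define A0 where "A0 = (LINT x|M. u x powr P) powr (1 / P)"
  define B0 where "B0 = (LINT x|M. v x powr P') powr (1 / P')"
  have nn0: "A0 \<ge> 0" "B0 \<ge> 0" by (simp_all add: A0_def B0_def)
  have pw: "(LINT x|M. u x powr P) = A0 powr P" "(LINT x|M. v x powr P') = B0 powr P'"
    using P by (simp_all add: A0_def B0_def powr_powr)
  have *: "(LINT x|M. u x * v x) \<le> (A0 + e) * (B0 + e)" if e: "e > 0" for e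
  proof -
    let ?A = "A0 + e" and ?B = "B0 + e"
    have AB: "?A > 0" "?B > 0" using e nn0 by auto
    have "u x * v x \<le> ?A * ?B * (u x powr P / (P * ?A powr P) + v x powr P' / (P' * ?B powr P'))" for x
    proof -
      have "(u x / ?A) * (v x / ?B) \<le> (u x / ?A) powr P / P + (v x / ?B) powr P' / P'"
        using nn AB by (intro Youngs_inequality P) auto
      then have "?A * ?B * ((u x / ?A) * (v x / ?B)) \<le> ?A * ?B * ((u x / ?A) powr P / P + (v x / ?B) powr P' / P')"
        using AB by (intro mult_left_mono) auto
      moreover have "?A * ?B * ((u x / ?A) * (v x / ?B)) = u x * v x" using AB by simp
      ultimately show ?thesis by (simp add: powr_divide mult.commute)
    qed
    then have "(LINT x|M. u x * v x) \<le>
        (LINT x|M. ?A * ?B * (u x powr P / (P * ?A powr P) + v x powr P' / (P' * ?B powr P')))"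
      using int I by (intro integral_mono) auto
    also have "\<dots> = ?A * ?B * (A0 powr P / (P * ?A powr P) + B0 powr P' / (P' * ?B powr P'))"
      using int by (simp add: pw)
    also have "\<dots> \<le> ?A * ?B * (1 / P + 1 / P')"
    proof (intro mult_left_mono add_mono)
      have "A0 powr P \<le> ?A powr P" using e nn0 P by (intro powr_mono2) auto
      then show "A0 powr P / (P * ?A powr P) \<le> 1 / P" using AB P by (simp add: divide_le_eq)
      have "B0 powr P' \<le> ?B powr P'" using e nn0 P by (intro powr_mono2) auto
      then show "B0 powr P' / (P' * ?B powr P') \<le> 1 / P'" using AB P by (simp add: divide_le_eq)
    qed (use AB in auto)
    finally show ?thesis using P by simp
  qed
  have "((\<lambda>e. (A0 + e) * (B0 + e)) \<longlongrightarrow> (A0 + 0) * (B0 + 0)) (at_right 0)"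
    by (intro tendsto_intros)
  then have "(LINT x|M. u x * v x) \<le> (A0 + 0) * (B0 + 0)"
    by (rule tendsto_lowerbound) (auto simp: eventually_at_right_less intro!: * eventually_at_rightI[of 0 1])
  then show "(LINT x|M. u x * v x) \<le> (LINT x|M. u x powr P) powr (1 / P) * (LINT x|M. v x powr P') powr (1 / P')"
    by (simp add: A0_def B0_def)
qed

lemma Holder_1_inf:
  assumes f: "f \<in> Lp_space 1 M" and g: "g \<in> Lp_space \<infinity> M"
  shows "integrable M (\<lambda>x. f x * g x)"
    and "norm (LINT x|M. f x * g x) \<le> Lp_norm 1 M f * Lp_norm \<infinity> M g"
proof -
  have fm: "f \<in> borel_measurable M" and fi: "integrable M (\<lambda>x. norm (f x))"
    using f by (simp_all add: Lp_space_finite_iff)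
  have gm: "g \<in> borel_measurable M" using g by (simp add: Lp_space_def)
  let ?N = "Lp_norm \<infinity> M g"
  have le: "AE x in M. norm (f x * g x) \<le> norm (f x) * ?N"
    using Linf_AE[OF g] by eventually_elim (simp add: norm_mult mult_left_mono)
  show I: "integrable M (\<lambda>x. f x * g x)"
  proof (rule Bochner_Integration.integrable_bound)
    show "integrable M (\<lambda>x. norm (f x) * ?N)" using fi by simp
    show "AE x in M. norm (f x * g x) \<le> norm (norm (f x) * ?N)"
      using le by eventually_elim simp
  qed (use fm gm in measurable)
  have "norm (LINT x|M. f x * g x) \<le> (LINT x|M. norm (f x * g x))" by (rule integral_norm_bound)
  also have "\<dots> \<le> (LINT x|M. norm (f x) * ?N)"
    using I fi le by (intro integral_mono_AE) auto
  also have "\<dots> = Lp_norm 1 M f * ?N" by (simp add: Lp_norm_finite)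
  finally show "norm (LINT x|M. f x * g x) \<le> Lp_norm 1 M f * ?N" .
qed

lemma Holder:
  assumes pp': "1 \<le> p" "1 \<le> p'" "1 / p + 1 / p' = 1"
    and f: "f \<in> Lp_space p M" and g: "g \<in> Lp_space p' M"
  shows "integrable M (\<lambda>x. f x * g x)"
    and "norm (LINT x|M. f x * g x) \<le> Lp_norm p M f * Lp_norm p' M g"
proof -
  have "integrable M (\<lambda>x. f x * g x) \<and> norm (LINT x|M. f x * g x) \<le> Lp_norm p M f * Lp_norm p' M g"
    using pp'
  proof (cases rule: conjugate_exponents_cases)
    case 1
    then show ?thesis using Holder_1_inf[of g M f] f g by (simp add: mult.commute)
  next
    case 2
    then show ?thesis using Holder_1_inf[of f M g] f g by simp
  next
    case (3 P P')
    have m: "f \<in> borel_measurable M" "g \<in> borel_measurable M"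
      and i: "integrable M (\<lambda>x. norm (f x) powr P)" "integrable M (\<lambda>x. norm (g x) powr P')"
      using f g 3 by (simp_all add: Lp_space_finite_iff)
    have nm: "(\<lambda>x. norm (f x)) \<in> borel_measurable M" "(\<lambda>x. norm (g x)) \<in> borel_measurable M"
      using m by auto
    note H = Holder_real[OF 3(3-5) nm norm_ge_zero norm_ge_zero i]
    have I: "integrable M (\<lambda>x. f x * g x)"
      using H(1) m by (intro Bochner_Integration.integrable_bound[OF H(1)]) (auto simp: norm_mult)
    have "norm (LINT x|M. f x * g x) \<le> (LINT x|M. norm (f x) * norm (g x))"
      using integral_norm_bound[of M "\<lambda>x. f x * g x"] by (simp add: norm_mult)
    with H(2) I 3 show ?thesis by (simp add: Lp_norm_finite)
  qed
  then show "integrable M (\<lambda>x. f x * g x)"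
    and "norm (LINT x|M. f x * g x) \<le> Lp_norm p M f * Lp_norm p' M g" by auto
qed

text \<open>The extremiser in the converse of Hoelder's inequality.\<close>

definition dual_function :: "real \<Rightarrow> ('a \<Rightarrow> complex) \<Rightarrow> 'a \<Rightarrow> complex" where
  "dual_function Q F x = cnj (F x) * of_real (norm (F x) powr (Q - 2))"

lemma mult_dual_function: "F x * dual_function Q F x = of_real (norm (F x) powr Q)"
proof (cases "F x = 0")
  case False
  have "F x * dual_function Q F x = (F x * cnj (F x)) * of_real (norm (F x) powr (Q - 2))"
    by (simp add: dual_function_def)
  also have "F x * cnj (F x) = of_real (norm (F x) powr 2)"
    using complex_norm_square[of "F x"] False by simp
  also have "of_real (norm (F x) powr 2) * complex_of_real (norm (F x) powr (Q - 2)) = of_real (norm (F x) powr Q)"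
    using False by (simp only: of_real_mult[symmetric] powr_add[symmetric]) simp
  finally show ?thesis .
qed (simp add: dual_function_def)

lemma norm_dual_function: "F x \<noteq> 0 \<Longrightarrow> norm (dual_function Q F x) = norm (F x) powr (Q - 1)"
proof -
  assume "F x \<noteq> 0"
  then have "norm (F x) * norm (F x) powr (Q - 2) = norm (F x) powr (1 + (Q - 2))"
    by (simp add: powr_mult_base)
  then show ?thesis by (simp add: dual_function_def norm_mult)
qed

text \<open>Since (Q - 1) Q' = Q, the power Q' of the modulus of the extremiser is the power Q of
  the modulus of \<open>F\<close>, so its norm is I^(1/Q') = I^(1 - 1/Q).\<close>

lemma dual_function_Lp:
  assumes qq': "1 \<le> q" "1 \<le> q'" "1 / q + 1 / q' = 1" and q: "q \<noteq> \<infinity>"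
    and F: "F \<in> Lp_space q M"
  defines "Q \<equiv> enn2real q"
  defines "I \<equiv> (LINT x|M. norm (F x) powr Q)"
  assumes I: "I > 0"
  shows "dual_function Q F \<in> Lp_space q' M" and "Lp_norm q' M (dual_function Q F) \<le> I powr (1 - 1 / Q)"
proof -
  have Fm [measurable]: "F \<in> borel_measurable M" using F q by (simp add: Lp_space_finite_iff)
  have [measurable]: "cnj \<in> borel_measurable borel"
    by (intro borel_measurable_continuous_onI continuous_intros)
  have m: "dual_function Q F \<in> borel_measurable M"
    unfolding dual_function_def[abs_def] by measurable
  have "dual_function Q F \<in> Lp_space q' M \<and> Lp_norm q' M (dual_function Q F) \<le> I powr (1 - 1 / Q)"
    using qq'
  proof (cases rule: conjugate_exponents_cases)
    case 1
    then show ?thesis using q by simp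
  next
    case 2
    \<comment> \<open>For \<open>q = 1\<close> the extremiser is a conjugate phase, or 0 where
      \<open>F\<close> vanishes; the target \<open>I powr 0\<close> is 1 because
      \<open>I > 0\<close>.\<close>
    have "norm (dual_function Q F x) \<le> 1" for x
      using norm_dual_function[of F x Q] 2 by (cases "F x = 0") (auto simp: Q_def dual_function_def)
    then show ?thesis using Linf_bounded[of "dual_function Q F" M 1] m 2 I by (simp add: Q_def)
  next
    case (3 P P')
    have QP: "Q = P" using 3 by (simp add: Q_def)
    have PP: "(P - 1) * P' = P" "1 / P' = 1 - 1 / P" using 3 by (auto simp: field_simps)
    have pw: "norm (dual_function Q F x) powr P' = norm (F x) powr Q" for x
      using norm_dual_function[of F x Q] PP by (cases "F x = 0") (auto simp: QP powr_powr dual_function_def)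
    then show ?thesis
      using 3 F m q PP by (simp add: Lp_space_finite_iff Lp_norm_finite QP I_def Q_def[symmetric])
  qed
  then show "dual_function Q F \<in> Lp_space q' M" and "Lp_norm q' M (dual_function Q F) \<le> I powr (1 - 1 / Q)"
    by auto
qed

lemma le_of_dual_bound:
  fixes I N Q :: real
  assumes "I > 0" "I \<le> N * I powr (1 - 1 / Q)"
  shows "I powr (1 / Q) \<le> N"
proof -
  have "I = I powr (1 / Q) * I powr (1 - 1 / Q)" using assms(1) by (simp flip: powr_add)
  with assms(2) have "I powr (1 / Q) * I powr (1 - 1 / Q) \<le> N * I powr (1 - 1 / Q)" by simp
  then show ?thesis using assms(1) by simp
qed

section \<open>Norms on the finite cube and on the torus\<close>

lemma count_space_Lp:
  assumes "finite A"
  shows "f \<in> Lp_space p (count_space A)"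
proof (cases "p = \<infinity>")
  case True
  have "f \<in> Lp_space \<infinity> (count_space A)"
  proof (rule Linf_bounded(1))
    show "AE x in count_space A. norm (f x) \<le> (\<Sum>x\<in>A. norm (f x))"
      using assms by (auto simp: AE_count_space intro: member_le_sum)
  qed (auto intro: sum_nonneg)
  then show ?thesis using True by simp
qed (use assms in \<open>simp add: Lp_space_finite_iff integrable_count_space\<close>)

lemma count_space_Lp_norm_finite:
  assumes "finite A" "p \<noteq> \<infinity>"
  shows "Lp_norm p (count_space A) f = (\<Sum>x\<in>A. norm (f x) powr enn2real p) powr (1 / enn2real p)"
  using assms by (simp add: Lp_norm_finite lebesgue_integral_count_space_finite)

lemma count_space_Linf_le:
  assumes "\<And>x. x \<in> A \<Longrightarrow> norm (f x) \<le> c" "c \<ge> 0"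
  shows "Lp_norm \<infinity> (count_space A) f \<le> c"
  using assms by (intro Linf_bounded(2)) (auto simp: AE_count_space)

lemma count_space_Lp_norm_cong:
  assumes "finite A" "\<And>x. x \<in> A \<Longrightarrow> f x = g x"
  shows "Lp_norm p (count_space A) f = Lp_norm p (count_space A) g"
proof -
  have "esssup (count_space A) (\<lambda>x. ennreal (norm (f x))) = esssup (count_space A) (\<lambda>x. ennreal (norm (g x)))"
    using assms by (intro esssup_AE_cong) (auto simp: AE_count_space)
  then show ?thesis
    using assms by (simp add: Lp_norm_def lebesgue_integral_count_space_finite)
qed

lemma torus_bounded_Lp:
  assumes "F \<in> borel_measurable (torus d)" "\<And>\<xi>. norm (F \<xi>) \<le> B"
  shows "F \<in> Lp_space q (torus d)"
proof (cases "q = \<infinity>")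
  case True
  have "B \<ge> 0" using assms(2)[of undefined] norm_ge_zero order_trans by blast
  then show ?thesis using True assms Linf_bounded(1)[of F "torus d" B] by auto
next
  case False
  have "integrable (torus d) (\<lambda>\<xi>. norm (F \<xi>) powr enn2real q)"
    using assms by (intro torus_integrable_bounded[of _ _ "B powr enn2real q"]) (auto intro!: powr_mono2)
  then show ?thesis using assms False by (simp add: Lp_space_finite_iff)
qed

lemma cube_poly_Lp: "cube_poly d f \<in> Lp_space q (torus d)"
  using cube_poly_measurable norm_cube_poly_le by (rule torus_bounded_Lp)

lemma Lp_norm_le_1_torus:
  assumes "1 \<le> q" "F \<in> borel_measurable (torus d)" "\<And>\<xi>. norm (F \<xi>) \<le> 1"
  shows "Lp_norm q (torus d) F \<le> 1"
proof (cases "q = \<infinity>")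
  case True
  then show ?thesis using assms Linf_bounded(2)[of F "torus d" 1] by auto
next
  case False
  interpret prob_space "torus d" by (rule prob_space_torus)
  let ?I = "LINT \<xi>|torus d. norm (F \<xi>) powr enn2real q"
  have pw: "norm (F \<xi>) powr enn2real q \<le> 1" for \<xi>
    using assms(3)[of \<xi>] powr_mono2[of "enn2real q" "norm (F \<xi>)" 1] by simp
  have "?I \<le> (LINT \<xi>|torus d. 1)"
    using pw assms by (intro integral_mono torus_integrable_bounded[of _ _ 1]) auto
  then have "?I powr (1 / enn2real q) \<le> 1 powr (1 / enn2real q)"
    by (intro powr_mono2 Bochner_Integration.integral_nonneg) (auto simp: prob_space)
  then show ?thesis using False by (simp add: Lp_norm_finite)
qed

text \<open>The multiplication formula on which the equivalence of the two estimates rests. Both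
  transforms have the same sign in the exponent, so the pairing is bilinear and contains no
  conjugation.\<close>

lemma fourier_duality:
  assumes g: "integrable (torus d) g"
  shows "(LINT \<xi>|torus d. g \<xi> * cube_poly d f \<xi>) = (\<Sum>x\<in>cube d. fourier_torus d g x * f x)"
proof -
  have int: "integrable (torus d) (\<lambda>\<xi>. g \<xi> * character d x \<xi>)" for x
    using g by (intro Bochner_Integration.integrable_bound[OF g]) (auto simp: norm_mult)
  have "(LINT \<xi>|torus d. g \<xi> * cube_poly d f \<xi>) = (LINT \<xi>|torus d. (\<Sum>x\<in>cube d. f x * (g \<xi> * character d x \<xi>)))"
    by (simp add: cube_poly_def sum_distrib_left mult_ac)
  also have "\<dots> = (\<Sum>x\<in>cube d. f x * (LINT \<xi>|torus d. g \<xi> * character d x \<xi>))"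
    using int by (subst Bochner_Integration.integral_sum) auto
  finally show ?thesis by (simp add: fourier_torus_def mult.commute)
qed

lemma Lp_torus_integrable:
  assumes "1 \<le> q" "1 \<le> q'" "1 / q + 1 / q' = 1" "g \<in> Lp_space q' (torus d)"
  shows "integrable (torus d) g"
proof -
  have "(\<lambda>_. 1) \<in> Lp_space q (torus d)" by (rule torus_bounded_Lp[of _ _ 1]) auto
  from Holder(1)[OF assms(1-3) this assms(4)] show ?thesis by simp
qed

text \<open>The coefficients of \<open>g\<close> are paired with their own Hoelder extremiser
  \<open>f\<close>; the pairing moves to the torus, where Hoelder and the estimate for
  \<open>f\<close> apply. The extremiser calls for finite \<open>p'\<close>; for
  \<open>p' = \<infinity>\<close> each coefficient is bounded directly, as characters have modulus
  1.\<close>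

lemma dual_estimate_of_estimate:
  assumes pp': "1 \<le> p" "1 \<le> p'" "1 / p + 1 / p' = 1"
    and qq': "1 \<le> q" "1 \<le> q'" "1 / q + 1 / q' = 1"
    and est: "\<And>f. Lp_norm q (torus d) (cube_poly d f) \<le> Lp_norm p (count_space (cube d)) f"
    and g: "g \<in> Lp_space q' (torus d)"
  shows "Lp_norm p' (count_space (cube d)) (fourier_torus d g) \<le> Lp_norm q' (torus d) g"
proof (cases "p' = \<infinity>")
  case True
  have "norm (fourier_torus d g x) \<le> Lp_norm q' (torus d) g" for x
  proof -
    have "character d x \<in> Lp_space q (torus d)"
      by (rule torus_bounded_Lp[of _ _ 1]) auto
    from Holder(2)[OF qq' this g] have "norm (fourier_torus d g x) \<le> Lp_norm q (torus d) (character d x) * Lp_norm q' (torus d) g"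
      by (simp add: fourier_torus_def mult.commute)
    also have "\<dots> \<le> 1 * Lp_norm q' (torus d) g"
      by (intro mult_right_mono Lp_norm_le_1_torus qq') auto
    finally show ?thesis by simp
  qed
  then show ?thesis unfolding True by (rule count_space_Linf_le) simp
next
  case False
  define G where "G = fourier_torus d g"
  define P' where "P' = enn2real p'"
  define I where "I = (LINT x|count_space (cube d). norm (G x) powr P')"
  define f where "f = dual_function P' G"
  have nrm: "Lp_norm p' (count_space (cube d)) G = I powr (1 / P')"
    using False by (simp add: Lp_norm_finite I_def P'_def)
  show ?thesis
  proof (cases "I > 0")
    case False
    moreover have "I \<ge> 0" unfolding I_def by (intro Bochner_Integration.integral_nonneg) auto
    ultimately have "I = 0" by simp
    then show ?thesis using nrm by (simp add: G_def)
  next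
    case True
    have p'p: "1 / p' + 1 / p = 1" using pp' by (simp add: add.commute)
    have fn: "Lp_norm p (count_space (cube d)) f \<le> I powr (1 - 1 / P')"
      unfolding f_def P'_def I_def
      by (rule dual_function_Lp(2)[OF pp'(2,1) p'p False count_space_Lp])
        (use True in \<open>simp_all add: I_def P'_def\<close>)
    have "complex_of_real I = (\<Sum>x\<in>cube d. G x * f x)"
      by (simp add: I_def lebesgue_integral_count_space_finite f_def mult_dual_function)
    also have "\<dots> = (LINT \<xi>|torus d. g \<xi> * cube_poly d f \<xi>)"
      using fourier_duality[OF Lp_torus_integrable[OF qq' g]] by (simp add: G_def)
    finally have e: "complex_of_real I = (LINT \<xi>|torus d. cube_poly d f \<xi> * g \<xi>)"
      by (simp only: mult.commute)
    have "I = norm (complex_of_real I)" using True by simp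
    also have "\<dots> = norm (LINT \<xi>|torus d. cube_poly d f \<xi> * g \<xi>)" unfolding e ..
    also have "\<dots> \<le> Lp_norm q (torus d) (cube_poly d f) * Lp_norm q' (torus d) g"
      by (rule Holder(2)[OF qq' cube_poly_Lp g])
    also have "\<dots> \<le> I powr (1 - 1 / P') * Lp_norm q' (torus d) g"
      using est[of f] fn by (intro mult_right_mono) auto
    finally have "I powr (1 / P') \<le> Lp_norm q' (torus d) g"
      using True by (intro le_of_dual_bound) (simp_all add: mult.commute)
    then show ?thesis using nrm by (simp add: G_def)
  qed
qed

text \<open>The same argument with the roles exchanged: the extremiser now belongs to the polynomial
  on the torus, hence the restriction to finite \<open>q\<close>.\<close>

lemma estimate_of_dual_estimate:
  assumes pp': "1 \<le> p" "1 \<le> p'" "1 / p + 1 / p' = 1"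
    and qq': "1 \<le> q" "1 \<le> q'" "1 / q + 1 / q' = 1" and q: "q \<noteq> \<infinity>"
    and est: "\<And>g. g \<in> Lp_space q' (torus d) \<Longrightarrow>
      Lp_norm p' (count_space (cube d)) (fourier_torus d g) \<le> Lp_norm q' (torus d) g"
  shows "Lp_norm q (torus d) (cube_poly d f) \<le> Lp_norm p (count_space (cube d)) f"
proof -
  define F where "F = cube_poly d f"
  define Q where "Q = enn2real q"
  define I where "I = (LINT \<xi>|torus d. norm (F \<xi>) powr Q)"
  define g where "g = dual_function Q F"
  have nrm: "Lp_norm q (torus d) F = I powr (1 / Q)"
    using q by (simp add: Lp_norm_finite I_def Q_def)
  show ?thesis
  proof (cases "I > 0")
    case False
    moreover have "I \<ge> 0" unfolding I_def by (intro Bochner_Integration.integral_nonneg) auto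
    ultimately have "I = 0" by simp
    then show ?thesis using nrm by (simp add: F_def)
  next
    case True
    have FL: "F \<in> Lp_space q (torus d)" unfolding F_def by (rule cube_poly_Lp)
    have gL: "g \<in> Lp_space q' (torus d)" and gn: "Lp_norm q' (torus d) g \<le> I powr (1 - 1 / Q)"
      using dual_function_Lp[OF qq' q FL] True by (simp_all add: g_def I_def Q_def)
    have "complex_of_real I = (LINT \<xi>|torus d. g \<xi> * F \<xi>)"
      using mult_dual_function[of F _ Q] by (simp add: I_def g_def mult.commute)
    also have "\<dots> = (\<Sum>x\<in>cube d. f x * fourier_torus d g x)"
      using fourier_duality[OF Lp_torus_integrable[OF qq' gL]] by (simp add: F_def mult.commute)
    also have "\<dots> = (LINT x|count_space (cube d). f x * fourier_torus d g x)"
      by (simp add: lebesgue_integral_count_space_finite)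
    finally have e: "complex_of_real I = (LINT x|count_space (cube d). f x * fourier_torus d g x)" .
    have "I = norm (complex_of_real I)" using True by simp
    also have "\<dots> = norm (LINT x|count_space (cube d). f x * fourier_torus d g x)" unfolding e ..
    also have "\<dots> \<le> Lp_norm p (count_space (cube d)) f * Lp_norm p' (count_space (cube d)) (fourier_torus d g)"
      by (rule Holder(2)[OF pp']) (simp_all add: count_space_Lp)
    also have "\<dots> \<le> Lp_norm p (count_space (cube d)) f * I powr (1 - 1 / Q)"
      using est[OF gL] gn by (intro mult_left_mono) auto
    finally have "I powr (1 / Q) \<le> Lp_norm p (count_space (cube d)) f"
      using True by (intro le_of_dual_bound) simp_all
    then show ?thesis using nrm by (simp add: F_def)
  qed
qed

section \<open>Sufficiency and necessity\<close>

lemma enn2real_inverse_ennreal: "P > 0 \<Longrightarrow> enn2real (1 / ennreal P) = 1 / P"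
  by (simp add: divide_ennreal flip: ennreal_1)

text \<open>Hoelder's inequality against the constant 1 on a probability space, with exponents
  \<open>2 / Q\<close> and \<open>2 / (2 - Q)\<close>.\<close>

lemma torus_norm_powr_mono:
  assumes Q: "0 < Q" "Q < 2" and F: "F \<in> borel_measurable (torus d)" "\<And>\<xi>. norm (F \<xi>) \<le> B"
  shows "(LINT \<xi>|torus d. norm (F \<xi>) powr Q) \<le> (LINT \<xi>|torus d. norm (F \<xi>) powr 2) powr (Q / 2)"
proof -
  interpret prob_space "torus d" by (rule prob_space_torus)
  note [measurable] = F(1)
  have "(LINT \<xi>|torus d. norm (F \<xi>) powr Q * 1) \<le>
      (LINT \<xi>|torus d. (norm (F \<xi>) powr Q) powr (2 / Q)) powr (1 / (2 / Q)) *
      (LINT \<xi>|torus d. 1 powr (2 / (2 - Q))) powr (1 / (2 / (2 - Q)))"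
  proof (rule Holder_real(2))
    show "1 < 2 / Q" "1 < 2 / (2 - Q)" "1 / (2 / Q) + 1 / (2 / (2 - Q)) = 1"
      using Q by (auto simp: field_simps)
    have "norm (F \<xi>) powr 2 \<le> B powr 2" for \<xi> using F(2)[of \<xi>] by (intro powr_mono2) auto
    then show "integrable (torus d) (\<lambda>\<xi>. (norm (F \<xi>) powr Q) powr (2 / Q))"
      using Q by (intro torus_integrable_bounded[of _ _ "B powr 2"]) (auto simp: powr_powr)
  qed auto
  then show ?thesis using Q by (simp add: powr_powr prob_space)
qed

lemma estimate_sufficient:
  fixes p q :: ennreal
  assumes p: "1 \<le> p" and q: "1 \<le> q"
    and h: "enn2real (1 / p) \<ge>
        (if q = \<infinity> then 1
         else if 2 \<le> q then
           1 / enn2real q * log 2 (real_binomial (enn2real q) (enn2real q / 2))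
         else 1 / 2)"
  shows "Lp_norm q (torus d) (cube_poly d f) \<le> Lp_norm p (count_space (cube d)) f"
proof -
  \<comment> \<open>This gives \<open>P \<le> 2\<close> in all three regimes, and therefore
    \<open>P \<le> Q\<close> when \<open>Q \<ge> 2\<close>, as tensorisation demands.\<close>
  have binom: "1 / Q * log 2 (real_binomial Q (Q / 2)) \<ge> 1 / 2" if "Q \<ge> 2" for Q
    using log2_central_binomial[OF that] that by (auto simp: field_simps)
  have two: "2 \<le> q \<longleftrightarrow> 2 \<le> enn2real q" if "q \<noteq> \<infinity>"
    using that by (cases q rule: ennreal_cases) (auto simp flip: ennreal_numeral)
  have inv_p: "enn2real (1 / p) \<ge> 1 / 2"
  proof (cases "q = \<infinity> \<or> \<not> 2 \<le> q")
    case False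
    then have "2 \<le> enn2real q" using two by blast
    moreover have "1 / enn2real q * log 2 (real_binomial (enn2real q) (enn2real q / 2)) \<le> enn2real (1 / p)"
      using False h by (auto split: if_splits)
    ultimately show ?thesis using binom[of "enn2real q"] by linarith
  qed (use h in \<open>auto split: if_splits\<close>)
  \<comment> \<open>At \<open>p = \<infinity>\<close> the value of \<open>enn2real (1 / p)\<close>
    is 0.\<close>
  then have "p \<noteq> \<infinity>" by auto
  then obtain P where P: "p = ennreal P" "P \<ge> 0" by (cases p rule: ennreal_cases) auto
  have P1: "P \<ge> 1" using p P by (simp flip: ennreal_1)
  have ip: "enn2real (1 / p) = 1 / P" unfolding P using P1 by (intro enn2real_inverse_ennreal) simp
  have P2: "P \<le> 2" using inv_p P1 unfolding ip by (simp add: field_simps)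
  have np: "Lp_norm p (count_space (cube d)) f = (\<Sum>x\<in>cube d. norm (f x) powr P) powr (1 / P)"
    using P by (simp add: count_space_Lp_norm_finite)
  show ?thesis
  proof (cases "q = \<infinity>")
    case True
    then have "1 \<le> 1 / P" using h unfolding ip by simp
    then have "P = 1" using P1 by (simp add: field_simps)
    then have "Lp_norm p (count_space (cube d)) f = (\<Sum>x\<in>cube d. norm (f x))"
      unfolding np by (simp add: sum_nonneg)
    moreover have "Lp_norm \<infinity> (torus d) (cube_poly d f) \<le> (\<Sum>x\<in>cube d. norm (f x))"
      by (rule Linf_bounded(2)) (auto simp: norm_cube_poly_le sum_nonneg)
    ultimately show ?thesis using True by simp
  next
    case False
    define Q where "Q = enn2real q"
    have Q1: "Q \<ge> 1" using q False enn2real_mono[of 1 q] by (simp add: Q_def top.not_eq_extremum)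
    have nq: "Lp_norm q (torus d) (cube_poly d f) = (LINT \<xi>|torus d. norm (cube_poly d f \<xi>) powr Q) powr (1 / Q)"
      using False by (simp add: Lp_norm_finite Q_def)
    have "(LINT \<xi>|torus d. norm (cube_poly d f \<xi>) powr Q) \<le> (\<Sum>x\<in>cube d. norm (f x) powr P) powr (Q / P)"
    proof (cases "2 \<le> Q")
      case True
      then have "1 / P \<ge> 1 / Q * log 2 (real_binomial Q (Q / 2))"
        using h two False unfolding ip by (simp add: Q_def)
      then show ?thesis
        using P1 P2 True by (intro tensorization two_point_inequality) auto
    next
      case False
      \<comment> \<open>For exponents below 2 the chain is L^Q to L^2 on the torus, the case of both
        exponents equal to 2, where the binomial condition is an equality, and the passage from
        exponent 2 to \<open>P\<close> on the cube.\<close>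
      have "real_binomial 2 1 = 2" using log2_central_binomial[of 2] by simp
      then have "(LINT \<xi>|torus d. norm (cube_poly d f \<xi>) powr 2) \<le> (\<Sum>x\<in>cube d. norm (f x) powr 2) powr (2 / 2)"
        by (intro tensorization two_point_inequality) auto
      also have "\<dots> = (\<Sum>x\<in>cube d. norm (f x) powr 2)" by (simp add: sum_nonneg)
      also have "\<dots> \<le> (\<Sum>x\<in>cube d. norm (f x) powr P) powr (2 / P)"
        using P1 P2 by (intro sum_powr_le_powr_sum) auto
      finally have "(LINT \<xi>|torus d. norm (cube_poly d f \<xi>) powr 2) powr (Q / 2) \<le>
          ((\<Sum>x\<in>cube d. norm (f x) powr P) powr (2 / P)) powr (Q / 2)"
        using Q1 by (intro powr_mono2 Bochner_Integration.integral_nonneg) auto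
      moreover have "(LINT \<xi>|torus d. norm (cube_poly d f \<xi>) powr Q) \<le>
          (LINT \<xi>|torus d. norm (cube_poly d f \<xi>) powr 2) powr (Q / 2)"
        using False Q1 by (intro torus_norm_powr_mono[OF _ _ cube_poly_measurable norm_cube_poly_le]) auto
      ultimately show ?thesis by (simp add: powr_powr)
    qed
    then have "(LINT \<xi>|torus d. norm (cube_poly d f \<xi>) powr Q) powr (1 / Q) \<le>
        ((\<Sum>x\<in>cube d. norm (f x) powr P) powr (Q / P)) powr (1 / Q)"
      using Q1 by (intro powr_mono2 Bochner_Integration.integral_nonneg) auto
    also have "\<dots> = (\<Sum>x\<in>cube d. norm (f x) powr P) powr (1 / P)"
      using Q1 by (simp add: powr_powr)
    finally show ?thesis unfolding nq np .
  qed
qed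

section \<open>Test functions in dimension one\<close>

abbreviation point1 :: "int \<Rightarrow> nat \<Rightarrow> int" where
  "point1 k \<equiv> (\<lambda>_. undefined)(0 := k)"

lemma point1_neq: "point1 1 \<noteq> point1 0"
  by (simp add: fun_eq_iff)

lemma sum_cube_1: "(\<Sum>x\<in>cube (Suc 0). g x) = g (point1 0) + g (point1 1)"
  by (simp only: sum_cube_Suc cube_0 sum.insert[OF finite.emptyI] empty_iff not_False_eq_True sum.empty add_0_right)

lemma card_cube_1: "card (cube (Suc 0)) = 2"
  by (simp only: card_eq_sum sum_cube_1 one_add_one)

lemma cube_poly_0 [simp]: "cube_poly 0 f \<xi> = f (\<lambda>_. undefined)"
  by (simp add: cube_poly_def cube_0 character_def)

lemma torus_1_norm:
  assumes "Q \<ge> 0"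
  shows "(LINT \<xi>|torus (Suc 0). norm (cube_poly (Suc 0) f \<xi>) powr Q) =
    (LINT t|circle. norm (f (point1 0) + f (point1 1) * cis (- (2 * pi * t))) powr Q)"
  by (subst torus_integral_Suc[OF cube_poly_integrable[OF assms]]) (simp add: cube_poly_Suc prob_space.prob_space[OF prob_space_torus])

text \<open>It lets one lower bound for the L^1 norm serve for every \<open>q\<close> at
  once.\<close>

lemma torus_L1_le_Lp:
  assumes qq': "1 \<le> q" "1 \<le> q'" "1 / q + 1 / q' = 1"
  shows "(LINT \<xi>|torus d. norm (cube_poly d f \<xi>)) \<le> Lp_norm q (torus d) (cube_poly d f)"
proof -
  let ?F = "\<lambda>\<xi>. complex_of_real (norm (cube_poly d f \<xi>))"
  have F: "?F \<in> Lp_space q (torus d)"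
    using norm_cube_poly_le[of d f] by (intro torus_bounded_Lp[of _ _ "\<Sum>x\<in>cube d. norm (f x)"]) auto
  have one: "(\<lambda>_. 1) \<in> Lp_space q' (torus d)" by (rule torus_bounded_Lp[of _ _ 1]) auto
  have "norm (LINT \<xi>|torus d. ?F \<xi> * 1) \<le> Lp_norm q (torus d) ?F * Lp_norm q' (torus d) (\<lambda>_. 1)"
    by (rule Holder(2)[OF qq' F one])
  also have "\<dots> \<le> Lp_norm q (torus d) ?F * 1"
    using qq' by (intro mult_left_mono Lp_norm_le_1_torus) auto
  also have "Lp_norm q (torus d) ?F = Lp_norm q (torus d) (cube_poly d f)"
    by (simp add: Lp_norm_def)
  finally show ?thesis by simp
qed

text \<open>The modulus of 1 + e z is the squared modulus of its square root. Replacing the root by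
  its second-order Taylor polynomial \<open>h\<close> changes the square only by terms of order e^3
  and e^4, and the squared modulus of \<open>h\<close> is a trigonometric polynomial that can be
  averaged exactly.\<close>

lemma norm_1_plus_cis_ge:
  fixes e x :: real
  assumes "e \<ge> 0"
  shows "norm (1 + of_real e * cis x) \<ge> 1 + (e / 2)\<^sup>2 + (e\<^sup>2 / 8)\<^sup>2 +
    2 * (e / 2) * (1 - e\<^sup>2 / 8) * cos x - 2 * (e\<^sup>2 / 8) * cos (2 * x) - e ^ 3 / 8 - e ^ 4 / 64"
proof -
  define z where "z = cis x"
  have z: "norm z = 1" by (simp add: z_def)
  \<comment> \<open>\<open>h\<close> is the Taylor polynomial of \<open>sqrt (1 + e z)\<close>.\<close>
  define h where "h = 1 + of_real (e / 2) * z - of_real (e\<^sup>2 / 8) * z\<^sup>2"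
  have "h\<^sup>2 = 1 + of_real e * z - of_real (e ^ 3 / 8) * z ^ 3 + of_real (e ^ 4 / 64) * z ^ 4"
    by (simp add: h_def field_simps power2_eq_square power3_eq_cube power4_eq_xxxx)
  then have "h\<^sup>2 = (1 + of_real e * z) + (of_real (e ^ 4 / 64) * z ^ 4 - of_real (e ^ 3 / 8) * z ^ 3)" by simp
  then have "(norm h)\<^sup>2 = norm ((1 + of_real e * z) + (of_real (e ^ 4 / 64) * z ^ 4 - of_real (e ^ 3 / 8) * z ^ 3))"
    by (simp flip: norm_power)
  also have "\<dots> \<le> norm (1 + of_real e * z) + (norm (of_real (e ^ 4 / 64) * z ^ 4) + norm (of_real (e ^ 3 / 8) * z ^ 3))"
    by (intro norm_triangle_mono norm_triangle_ineq4) simp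
  also have "\<dots> = norm (1 + of_real e * z) + (e ^ 4 / 64 + e ^ 3 / 8)"
    using assms z by (simp add: norm_mult norm_power norm_divide)
  finally have main: "norm (1 + of_real e * z) \<ge> (norm h)\<^sup>2 - e ^ 3 / 8 - e ^ 4 / 64" by simp
  have "(norm h)\<^sup>2 = 1 + (e / 2)\<^sup>2 + (e\<^sup>2 / 8)\<^sup>2 + 2 * (e / 2) * (1 - e\<^sup>2 / 8) * cos x - 2 * (e\<^sup>2 / 8) * cos (2 * x)"
  proof -
    have z2: "z\<^sup>2 = cis (2 * x)" by (simp add: z_def power2_eq_square cis_mult)
    have "(1 + a * c - b * c2)\<^sup>2 + (a * s - b * s2)\<^sup>2 =
        1 + a\<^sup>2 * (c\<^sup>2 + s\<^sup>2) + b\<^sup>2 * (c2\<^sup>2 + s2\<^sup>2) + 2 * a * c - 2 * a * b * (c2 * c + s2 * s) - 2 * b * c2"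
      for a b c c2 s s2 :: real
      by (simp add: power2_eq_square algebra_simps)
    from this[of "e / 2" "cos x" "e\<^sup>2 / 8" "cos (2 * x)" "sin x" "sin (2 * x)"]
    have "(norm h)\<^sup>2 = 1 + (e / 2)\<^sup>2 + (e\<^sup>2 / 8)\<^sup>2 + 2 * (e / 2) * cos x
        - 2 * (e / 2) * (e\<^sup>2 / 8) * (cos (2 * x) * cos x + sin (2 * x) * sin x) - 2 * (e\<^sup>2 / 8) * cos (2 * x)"
      unfolding cmod_power2 h_def z2 by (simp add: z_def)
    also have "cos (2 * x) * cos x + sin (2 * x) * sin x = cos x"
      using cos_diff[of "2 * x" x] by simp
    finally show ?thesis by (simp add: algebra_simps)
  qed
  with main show ?thesis by (simp add: z_def)
qed

lemma circle_L1_perturbation: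
  assumes "e \<ge> 0"
  shows "(LINT t|circle. norm (1 + of_real e * cis (- (2 * pi * t)))) \<ge> 1 + e\<^sup>2 / 4 - e ^ 3 / 8"
proof -
  let ?f = "\<lambda>t. norm (1 + of_real e * cis (- (2 * pi * t)))"
  let ?K = "1 + (e / 2)\<^sup>2 + (e\<^sup>2 / 8)\<^sup>2 - e ^ 3 / 8 - e ^ 4 / 64"
  let ?g = "\<lambda>t. ?K + 2 * (e / 2) * (1 - e\<^sup>2 / 8) * cos (2 * pi * t) + (- (2 * (e\<^sup>2 / 8))) * cos (2 * pi * (real 2 * t))"
  have cont: "continuous_on S ?f" for S by (intro continuous_intros)
  have g: "(?g has_integral ?K) {0..1}"
    using has_integral_add[OF has_integral_add[OF has_integral_const_real[of ?K 0 1]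
        has_integral_mult_right[OF has_integral_cos, of "2 * (e / 2) * (1 - e\<^sup>2 / 8)"]]
        has_integral_mult_right[OF has_integral_cos_multiple[of 2], of "- (2 * (e\<^sup>2 / 8))"]]
    by simp
  have "?K \<le> integral {0..1} ?f"
  proof (rule has_integral_le[OF g])
    show "(?f has_integral integral {0..1} ?f) {0..1}"
      by (intro integrable_integral integrable_continuous_interval cont)
    show "?g t \<le> ?f t" for t
      using norm_1_plus_cis_ge[OF assms, of "- (2 * pi * t)"] by (simp add: mult_ac)
  qed
  \<comment> \<open>The two fourth-order terms cancel exactly.\<close>
  moreover have "?K = 1 + e\<^sup>2 / 4 - e ^ 3 / 8"
    by (simp add: power_divide power4_eq_xxxx power2_eq_square)
  ultimately show ?thesis by (simp add: circle_integral_eq[OF cont])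
qed

text \<open>For f = 1 the left-hand norm is \<open>B powr (1 / Q)\<close> by the evaluation at x =
  1, and the right-hand norm is at most 2^(1/p); the claim is the binary logarithm of this
  comparison.\<close>

lemma estimate_necessary_binomial:
  assumes p: "1 \<le> p" and q: "1 \<le> q" "q \<noteq> \<infinity>"
    and est: "\<And>f. Lp_norm q (torus (Suc 0)) (cube_poly (Suc 0) f) \<le> Lp_norm p (count_space (cube (Suc 0))) f"
  shows "enn2real (1 / p) \<ge> 1 / enn2real q * log 2 (real_binomial (enn2real q) (enn2real q / 2))"
proof -
  define Q where "Q = enn2real q"
  define B where "B = real_binomial Q (Q / 2)"
  have Q: "Q \<ge> 1" using q enn2real_mono[of 1 q] by (simp add: Q_def top.not_eq_extremum)
  have B: "B = cos_integral (Q / 2) 1" using cos_integral_1[of "Q / 2"] Q by (simp add: B_def)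
  have Bpos: "B > 0" unfolding B using Q by (intro cos_integral_pos) auto
  have "Lp_norm q (torus (Suc 0)) (cube_poly (Suc 0) (\<lambda>_. 1)) = B powr (1 / Q)"
  proof -
    have "(LINT \<xi>|torus (Suc 0). norm (cube_poly (Suc 0) (\<lambda>_. 1) \<xi>) powr Q) =
        (LINT t|circle. norm (1 + 1 * cis (- (2 * pi * t))) powr Q)"
      using Q by (intro torus_1_norm) auto
    also have "\<dots> = B" using Q by (subst two_point_integral_eq_cos_integral) (auto simp: B)
    finally show ?thesis using q by (simp add: Lp_norm_finite flip: Q_def)
  qed
  moreover have "Lp_norm p (count_space (cube (Suc 0))) (\<lambda>_. 1) \<le> 2 powr enn2real (1 / p)"
  proof (cases p rule: ennreal_cases)
    case top
    then show ?thesis using count_space_Linf_le[of "cube (Suc 0)" "\<lambda>_. 1" 1] by simp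
  next
    case (real P)
    then have "P \<ge> 1" using p by (simp flip: ennreal_1)
    then have "enn2real (1 / p) = 1 / P" using real enn2real_inverse_ennreal[of P] by simp
    then show ?thesis using real by (simp add: count_space_Lp_norm_finite card_cube_1)
  qed
  ultimately have "B powr (1 / Q) \<le> 2 powr enn2real (1 / p)" using est[of "\<lambda>_. 1"] by linarith
  then have "log 2 (B powr (1 / Q)) \<le> log 2 (2 powr enn2real (1 / p))"
    using Bpos by (subst log_le_cancel_iff) auto
  then show ?thesis using Bpos by (simp add: log_powr B_def Q_def)
qed

text \<open>Putting mass \<open>e\<close> on the second point raises the left-hand norm by order e^2
  for every \<open>q\<close>, but the right-hand norm by at most e^P, which is too small if
  \<open>P > 2\<close>.\<close>

lemma estimate_necessary_half:
  assumes p: "1 \<le> p" and qq': "1 \<le> q" "1 \<le> q'" "1 / q + 1 / q' = 1"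
    and est: "\<And>f. Lp_norm q (torus (Suc 0)) (cube_poly (Suc 0) f) \<le> Lp_norm p (count_space (cube (Suc 0))) f"
  shows "enn2real (1 / p) \<ge> 1 / 2"
proof (rule ccontr)
  assume neg: "\<not> enn2real (1 / p) \<ge> 1 / 2"
  have lower: "1 + e\<^sup>2 / 4 - e ^ 3 / 8 \<le> Lp_norm p (count_space (cube (Suc 0))) (\<lambda>x. if x = point1 0 then 1 else of_real e)"
    if e: "e \<ge> 0" for e
  proof -
    let ?f = "\<lambda>x. if x = point1 0 then 1 else complex_of_real e"
    have "(LINT \<xi>|torus (Suc 0). norm (cube_poly (Suc 0) ?f \<xi>) powr 1) =
        (LINT t|circle. norm (1 + of_real e * cis (- (2 * pi * t))) powr 1)"
      by (subst torus_1_norm) (simp_all add: point1_neq)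
    then have "1 + e\<^sup>2 / 4 - e ^ 3 / 8 \<le> (LINT \<xi>|torus (Suc 0). norm (cube_poly (Suc 0) ?f \<xi>))"
      using circle_L1_perturbation[OF e] by simp
    also have "\<dots> \<le> Lp_norm q (torus (Suc 0)) (cube_poly (Suc 0) ?f)" by (rule torus_L1_le_Lp[OF qq'])
    also have "\<dots> \<le> Lp_norm p (count_space (cube (Suc 0))) ?f" by (rule est)
    finally show ?thesis .
  qed
  show False
  proof (cases p rule: ennreal_cases)
    case top
    \<comment> \<open>For \<open>p = \<infinity>\<close> the choice e = 1 suffices, the lower bound
      being 9/8.\<close>
    have "Lp_norm p (count_space (cube (Suc 0))) (\<lambda>x. if x = point1 0 then 1 else of_real 1) \<le> 1"
      using top count_space_Linf_le[of "cube (Suc 0)" "\<lambda>x. if x = point1 0 then 1 else of_real 1" 1] by simp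
    then show False using lower[of 1] by simp
  next
    case (real P)
    then have P1: "P \<ge> 1" using p by (simp flip: ennreal_1)
    then have "enn2real (1 / p) = 1 / P" using real enn2real_inverse_ennreal[of P] by simp
    then have "1 / P < 1 / 2" using neg by linarith
    then have P2: "P > 2" using P1 by (simp add: divide_less_eq)
    \<comment> \<open>Chosen so that e^P = e^2 / 16. Since e^3 \<le> e^2, the left-hand gain is at
      least e^2 / 8, which exceeds e^2 / 16.\<close>
    define e :: real where "e = (1 / 16) powr (1 / (P - 2))"
    have e: "0 < e" "e \<le> 1" using P2 by (auto simp: e_def powr_le1)
    have eP: "e powr P = e\<^sup>2 / 16"
    proof -
      have "e powr (P - 2) = 1 / 16" using P2 by (simp add: e_def powr_powr)
      moreover have "e powr P = e powr 2 * e powr (P - 2)" by (simp flip: powr_add)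
      ultimately show ?thesis using e by simp
    qed
    have "1 + e\<^sup>2 / 4 - e ^ 3 / 8 \<le> (1 + e powr P) powr (1 / P)"
      using lower[of e] e real
      by (simp add: count_space_Lp_norm_finite sum_cube_1 point1_neq)
    also have "\<dots> \<le> (1 + e powr P) powr 1"
      using P1 by (intro powr_mono) auto
    also have "\<dots> = 1 + e\<^sup>2 / 16" using eP by (simp add: add_nonneg_nonneg)
    finally have "e\<^sup>2 / 4 - e ^ 3 / 8 \<le> e\<^sup>2 / 16" by simp
    moreover have "e ^ 3 \<le> e\<^sup>2" using e by (intro power_decreasing) auto
    moreover have "e\<^sup>2 > 0" using e by simp
    ultimately show False by simp
  qed
qed

text \<open>The Fejer kernel of order one is nonnegative, so its zeroth Fourier coefficient
  already equals its \<open>L\<^sup>1\<close> norm.\<close>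

lemma dual_estimate_necessary_L1:
  assumes pp': "1 \<le> p" "1 \<le> p'" "1 / p + 1 / p' = 1"
    and est: "\<And>g. g \<in> Lp_space 1 (torus (Suc 0)) \<Longrightarrow>
      Lp_norm p' (count_space (cube (Suc 0))) (fourier_torus (Suc 0) g) \<le> Lp_norm 1 (torus (Suc 0)) g"
  shows "p = 1"
proof (rule ccontr)
  assume "p \<noteq> 1"
  \<comment> \<open>If \<open>p\<close> is not 1, then \<open>p'\<close> is finite, so a second
    nonzero coefficient strictly increases the norm of the coefficients.\<close>
  with pp' obtain P' where P': "p' = ennreal P'" "P' \<ge> 1"
    by (cases rule: conjugate_exponents_cases) (auto intro: that[of 1])
  define g where "g \<xi> = complex_of_real (1 + cos (2 * pi * \<xi> (0::nat)))" for \<xi>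
  have [measurable]: "(\<lambda>\<xi>. \<xi> 0) \<in> borel_measurable (torus (Suc 0))" by (rule component_measurable_torus) simp
  have gm: "g \<in> borel_measurable (torus (Suc 0))" unfolding g_def by measurable
  have gn: "norm (g \<xi>) = 1 + cos (2 * pi * \<xi> 0)" for \<xi>
  proof -
    have "1 + cos (2 * pi * \<xi> 0) \<ge> 0" using cos_ge_minus_one[of "2 * pi * \<xi> 0"] by linarith
    then show ?thesis unfolding g_def norm_of_real by (rule abs_of_nonneg)
  qed
  have gb: "norm (g \<xi>) \<le> 2" for \<xi> unfolding gn using cos_le_one[of "2 * pi * \<xi> 0"] by simp
  have L1: "Lp_norm 1 (torus (Suc 0)) g = 1"
  proof -
    have "(LINT \<xi>|torus (Suc 0). norm (g \<xi>)) = (LINT t|circle. 1 + cos (2 * pi * t))"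
    proof (subst torus_integral_Suc)
      show "integrable (torus (Suc 0)) (\<lambda>\<xi>. norm (g \<xi>))"
        using gm gb by (intro torus_integrable_bounded[of _ _ 2]) auto
    qed (simp add: gn prob_space.prob_space[OF prob_space_torus])
    also have "\<dots> = integral {0..1} (\<lambda>t. 1 + cos (2 * pi * t))"
      by (intro circle_integral_eq continuous_intros)
    also have "\<dots> = 1"
      using has_integral_add[OF has_integral_const_real[of 1 0 1] has_integral_cos] by (simp add: integral_unique)
    finally show ?thesis by (simp add: Lp_norm_finite)
  qed
  have ch: "character (Suc 0) (point1 k) \<xi> = cis (- (2 * pi * (k * \<xi> 0)))" for k \<xi>
    by (simp add: character_def cis_conv_exp mult_ac)
  have c0: "norm (fourier_torus (Suc 0) g (point1 0)) = 1"
  proof -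
    have "g \<xi> * character (Suc 0) (point1 0) \<xi> = complex_of_real (norm (g \<xi>))" for \<xi>
      unfolding gn by (simp add: ch g_def)
    then have "fourier_torus (Suc 0) g (point1 0) = of_real (LINT \<xi>|torus (Suc 0). norm (g \<xi>))"
      by (simp add: fourier_torus_def)
    then show ?thesis using L1 by (simp add: Lp_norm_finite)
  qed
  \<comment> \<open>The real part of this coefficient is the mean of cos^2, the linear cosine term
    having mean 0.\<close>
  have c1: "norm (fourier_torus (Suc 0) g (point1 1)) > 0"
  proof -
    have int: "integrable (torus (Suc 0)) (\<lambda>\<xi>. g \<xi> * character (Suc 0) (point1 1) \<xi>)"
      using gm gb by (intro torus_integrable_bounded[of _ _ 2]) (auto simp: norm_mult)
    have "Re (fourier_torus (Suc 0) g (point1 1)) = (LINT \<xi>|torus (Suc 0). Re (g \<xi> * character (Suc 0) (point1 1) \<xi>))"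
      unfolding fourier_torus_def using int by (rule integral_Re[symmetric])
    also have "\<dots> = (LINT t|circle. (1 + cos (2 * pi * t)) * cos (2 * pi * t))"
    proof (subst torus_integral_Suc)
      show "integrable (torus (Suc 0)) (\<lambda>\<xi>. Re (g \<xi> * character (Suc 0) (point1 1) \<xi>))"
        using int by (rule integrable_Re)
    qed (simp add: ch g_def prob_space.prob_space[OF prob_space_torus])
    also have "\<dots> = integral {0..1} (\<lambda>t. (1 + cos (2 * pi * t)) * cos (2 * pi * t))"
      by (intro circle_integral_eq continuous_intros)
    also have "\<dots> = integral {0..1} (\<lambda>t. cos (2 * pi * t) + (cos (2 * pi * t))\<^sup>2)"
      by (simp add: algebra_simps power2_eq_square)
    also have "\<dots> = integral {0..1} (\<lambda>t. cos (2 * pi * t)) + integral {0..1} (\<lambda>t. (cos (2 * pi * t))\<^sup>2)"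
      by (intro Henstock_Kurzweil_Integration.integral_add integrable_continuous_interval continuous_intros)
    also have "integral {0..1} (\<lambda>t. cos (2 * pi * t)) = 0"
      using has_integral_cos by (rule integral_unique)
    finally have "Re (fourier_torus (Suc 0) g (point1 1)) = integral {0..1} (\<lambda>t. (cos (2 * pi * t))\<^sup>2)"
      by (simp only: add_0)
    also have "\<dots> > 0"
      by (rule integral_pos_if_pos_at_point[where s = 0]) (auto intro!: continuous_intros)
    finally show ?thesis by auto
  qed
  have "Lp_norm p' (count_space (cube (Suc 0))) (fourier_torus (Suc 0) g) =
      (1 + norm (fourier_torus (Suc 0) g (point1 1)) powr P') powr (1 / P')"
    using P' c0 by (simp add: count_space_Lp_norm_finite sum_cube_1)
  also have "\<dots> > 1 powr (1 / P')" using c1 P' by (intro powr_less_mono2) auto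
  finally have "Lp_norm p' (count_space (cube (Suc 0))) (fourier_torus (Suc 0) g) > 1" by simp
  moreover have "g \<in> Lp_space 1 (torus (Suc 0))" using gm gb by (rule torus_bounded_Lp)
  ultimately show False using est[of g] L1 by simp
qed

section \<open>Closing the cycle of implications\<close>

theorem theorem1:
  fixes p q p' q' :: ennreal
  assumes "1 \<le> p" and "1 \<le> q"
    and "1 \<le> p'" and "1 \<le> q'"
    and "1 / p + 1 / p' = 1" and "1 / q + 1 / q' = 1"
  shows
    "((\<forall>d>0. \<forall>f :: (nat \<Rightarrow> int) \<Rightarrow> complex.
         (\<forall>x \<in> lattice d. x \<notin> cube d \<longrightarrow> f x = 0) \<longrightarrow>
         Lp_norm q (torus d) (fourier_lattice d f) \<le> Lp_norm p (count_space (cube d)) f)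
      \<longleftrightarrow>
      (\<forall>d>0. \<forall>g \<in> Lp_space q' (torus d).
         Lp_norm p' (count_space (cube d)) (fourier_torus d g) \<le> Lp_norm q' (torus d) g))
     \<and>
     ((\<forall>d>0. \<forall>g \<in> Lp_space q' (torus d).
         Lp_norm p' (count_space (cube d)) (fourier_torus d g) \<le> Lp_norm q' (torus d) g)
      \<longleftrightarrow>
      enn2real (1 / p) \<ge>
        (if q = \<infinity> then 1
         else if 2 \<le> q then
           1 / enn2real q * log 2 (real_binomial (enn2real q) (enn2real q / 2))
         else 1 / 2))"
    (is "(?E \<longleftrightarrow> ?D) \<and> (_ \<longleftrightarrow> ?C)")
proof -
  note pp' = assms(1,3,5) and qq' = assms(2,4,6)
  have 1: "?D" if E: ?E
  proof (intro allI impI ballI)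
    fix d :: nat and g assume d: "d > 0" and g: "g \<in> Lp_space q' (torus d)"
    have "Lp_norm q (torus d) (cube_poly d f) \<le> Lp_norm p (count_space (cube d)) f" for f
    proof -
      \<comment> \<open>Condition (1) concerns functions vanishing off the cube, while
        \<open>cube_poly\<close> and the counting norm see only values on the cube; truncation
        reconciles the two.\<close>
      define f0 where "f0 x = (if x \<in> cube d then f x else 0)" for x
      have "fourier_lattice d f0 = cube_poly d f0"
        by (rule fourier_lattice_eq_cube_poly) (simp add: f0_def)
      also have "\<dots> = cube_poly d f" by (simp add: cube_poly_def[abs_def] f0_def)
      finally have "Lp_norm q (torus d) (cube_poly d f) \<le> Lp_norm p (count_space (cube d)) f0"
        using E d f0_def by (metis (full_types))
      also have "\<dots> = Lp_norm p (count_space (cube d)) f"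
        by (rule count_space_Lp_norm_cong) (simp_all add: f0_def)
      finally show ?thesis .
    qed
    from dual_estimate_of_estimate[OF pp' qq' this g]
    show "Lp_norm p' (count_space (cube d)) (fourier_torus d g) \<le> Lp_norm q' (torus d) g" .
  qed
  have 2: "?C" if D: ?D
  \<comment> \<open>For \<open>q = \<infinity>\<close> the passage back through duality has no
    extremiser, so the dual estimate is tested directly with \<open>q' = 1\<close>. For finite
    \<open>q\<close> it is first turned into the estimate in dimension one.\<close>
  proof (cases "q = \<infinity>")
    case True
    from qq' have "q' = 1" by (cases rule: conjugate_exponents_cases) (use True in auto)
    then have "p = 1" using dual_estimate_necessary_L1[OF pp'] D by blast
    then show ?thesis using True by simp
  next
    case False
    have est: "Lp_norm q (torus (Suc 0)) (cube_poly (Suc 0) f) \<le> Lp_norm p (count_space (cube (Suc 0))) f" for f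
      using D by (intro estimate_of_dual_estimate[OF pp' qq' False]) blast
    show ?thesis
      using False estimate_necessary_binomial[OF assms(1,2) False est]
        estimate_necessary_half[OF assms(1) qq' est] by simp
  qed
  have 3: "?E" if C: ?C
  proof (intro allI impI)
    fix d :: nat and f :: "(nat \<Rightarrow> int) \<Rightarrow> complex"
    assume "\<forall>x\<in>lattice d. x \<notin> cube d \<longrightarrow> f x = 0"
    then have "fourier_lattice d f = cube_poly d f" by (intro fourier_lattice_eq_cube_poly) blast
    then show "Lp_norm q (torus d) (fourier_lattice d f) \<le> Lp_norm p (count_space (cube d)) f"
      using estimate_sufficient[OF assms(1,2) C] by simp
  qed
  from 1 2 3 show ?thesis by blast
qed

end
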